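(* Let $u$ be a real-valued function on $\mathbb{R}$ with $u\in L^2(\mathbb{R})\cap L^\infty(\mathbb{R})$ and $xu(x)\in L^2(\mathbb{R})$. If $\lambda<0$ is an eigenvalue of $L_u$ and $\varphi$ is an eigenvector of $L_u$ for $\lambda$, then $$\left|\int_{\mathbb{R}}u\varphi\,dx\right|^2=2\pi|\lambda|\int_{\mathbb{R}}|\varphi|^2\,dx.$$
   Context: Fourier transform convention: $\hat f(\xi)=\int_{\mathbb{R}}e^{-ix\xi}f(x)\,dx$. $H^+$ is the Hardy space of (complex-valued) functions in $L^2(\mathbb{R})$ whose Fourier transform is supported on $[0,\infty)$, with the $L^2$ inner product. $C_+$ is the Cauchy projection, $\widehat{C_+\varphi}=\chi_{\mathbb{R}_+}\hat\varphi$, i.e. the orthogonal projection of $L^2(\mathbb{R})$ onto $H^+$. $L_u$ is the self-adjoint operator $L_u\varphi=\frac1i\varphi_x-C_+(uC_+\varphi)$ on $H^+$ with domain $H^+\cap H^1(\mathbb{R})$, where $H^1(\mathbb{R})$ is the $L^2$ Sobolev space. *)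

theory Defs
  imports "HOL-Analysis.Analysis"
begin

text \<open>
  Elements of \<open>L\<^sup>2\<close> and \<open>L\<^sup>\<infinity>\<close> are represented by functions rather than by
  equivalence classes. Operations that are determined only up to null sets (the Fourier--Plancherel
  transform, the Cauchy projection, weak derivatives, the operator \<open>L\<^sub>u\<close>) are therefore relations
  between an argument and a representative of its image.
\<close>

definition L2 :: "(real \<Rightarrow> 'a::real_normed_vector) set" where
  "L2 = {f. f \<in> borel_measurable lebesgue \<and> integrable lebesgue (\<lambda>x. (norm (f x))\<^sup>2)}"

definition Linfty :: "(real \<Rightarrow> 'a::real_normed_vector) set" where
  "Linfty = {f. f \<in> borel_measurable lebesgue \<and> (\<exists>C. AE x in lebesgue. norm (f x) \<le> C)}"

definition fourier_integral :: "(real \<Rightarrow> complex) \<Rightarrow> real \<Rightarrow> complex" where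
  "fourier_integral f \<xi> = (LINT x|lebesgue. exp (- (\<i> * of_real x * of_real \<xi>)) * f x)"

text \<open>
  On \<open>L\<^sup>2\<close> the Fourier transform is the \<open>L\<^sup>2\<close> limit of the Fourier integrals of the truncations
  of \<open>f\<close> to \<open>[-R, R]\<close>, which are integrable. The distance is a nonnegative (possibly infinite)
  integral, so that convergence to 0 cannot hold through the convention for non-integrable functions.
\<close>

definition has_fourier_transform :: "(real \<Rightarrow> complex) \<Rightarrow> (real \<Rightarrow> complex) \<Rightarrow> bool" where
  "has_fourier_transform f g \<longleftrightarrow> f \<in> L2 \<and> g \<in> L2 \<and>
     ((\<lambda>R. \<integral>\<^sup>+\<xi>. ennreal ((cmod (fourier_integral (\<lambda>x. indicator {-R..R} x * f x) \<xi> - g \<xi>))\<^sup>2)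
        \<partial>lebesgue) \<longlongrightarrow> 0) at_top"

definition hardy_space :: "(real \<Rightarrow> complex) set" where
  "hardy_space = {f \<in> L2. \<exists>g. has_fourier_transform f g \<and> (AE \<xi> in lebesgue. \<xi> < 0 \<longrightarrow> g \<xi> = 0)}"

definition cauchy_projection :: "(real \<Rightarrow> complex) \<Rightarrow> (real \<Rightarrow> complex) \<Rightarrow> bool" where
  "cauchy_projection f h \<longleftrightarrow>
     (\<exists>g. has_fourier_transform f g \<and> has_fourier_transform h (\<lambda>\<xi>. indicator {0..} \<xi> * g \<xi>))"

definition test_function :: "(real \<Rightarrow> real) \<Rightarrow> bool" where
  "test_function \<eta> \<longleftrightarrow>
     (\<forall>n x. (deriv ^^ n) \<eta> differentiable (at x)) \<and> compact (closure {x. \<eta> x \<noteq> 0})"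

text \<open>
  Only used for \<open>f\<close> and \<open>f'\<close> in \<open>L2\<close>, where both integrands are integrable.
\<close>

definition weak_derivative :: "(real \<Rightarrow> complex) \<Rightarrow> (real \<Rightarrow> complex) \<Rightarrow> bool" where
  "weak_derivative f f' \<longleftrightarrow>
     (\<forall>\<eta>. test_function \<eta> \<longrightarrow>
        (LINT x|lebesgue. f x * of_real (deriv \<eta> x)) = - (LINT x|lebesgue. f' x * of_real (\<eta> x)))"

definition sobolev_H1 :: "(real \<Rightarrow> complex) set" where
  "sobolev_H1 = {f \<in> L2. \<exists>f' \<in> L2. weak_derivative f f'}"

text \<open>
  The graph of \<open>L\<^sub>u \<phi> = (1/i) \<phi>\<^sub>x - C\<^sub>+ (u C\<^sub>+ \<phi>)\<close>: here \<open>p\<close> represents \<open>C\<^sub>+ \<phi>\<close> and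
  \<open>q\<close> represents \<open>C\<^sub>+ (u C\<^sub>+ \<phi>)\<close>.
\<close>

definition Lu_graph :: "(real \<Rightarrow> real) \<Rightarrow> (real \<Rightarrow> complex) \<Rightarrow> (real \<Rightarrow> complex) \<Rightarrow> bool" where
  "Lu_graph u \<phi> \<psi> \<longleftrightarrow> \<phi> \<in> hardy_space \<inter> sobolev_H1 \<and>
     (\<exists>\<phi>' \<in> L2. \<exists>p q. weak_derivative \<phi> \<phi>' \<and> cauchy_projection \<phi> p \<and>
        cauchy_projection (\<lambda>x. of_real (u x) * p x) q \<and>
        (AE x in lebesgue. \<psi> x = (1 / \<i>) * \<phi>' x - q x))"

definition Lu_eigenvector :: "(real \<Rightarrow> real) \<Rightarrow> complex \<Rightarrow> (real \<Rightarrow> complex) \<Rightarrow> bool" where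
  "Lu_eigenvector u \<mu> \<phi> \<longleftrightarrow>
     \<not> (AE x in lebesgue. \<phi> x = 0) \<and> Lu_graph u \<phi> (\<lambda>x. \<mu> * \<phi> x)"

definition Lu_eigenvalue :: "(real \<Rightarrow> real) \<Rightarrow> complex \<Rightarrow> bool" where
  "Lu_eigenvalue u \<mu> \<longleftrightarrow> (\<exists>\<phi>. Lu_eigenvector u \<mu> \<phi>)"

end

theory Submission
  imports Defs "HOL-Probability.Probability"
begin

text \<open>
  Write \<open>g\<close> for the Fourier transform of \<open>\<phi>\<close> and \<open>F \<xi> = \<integral> exp (- i x \<xi>) u \<phi> dx\<close>. As \<open>u \<phi>\<close> and \<open>x u \<phi>\<close> are
  integrable, \<open>F\<close> is bounded and continuously differentiable. Taking transforms, the eigenvalue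
  equation becomes \<open>(\<xi> - l) g = F\<close> for \<open>\<xi> \<ge> 0\<close>, while \<open>g = 0\<close> for \<open>\<xi> < 0\<close>. Hence on the half-line
  \<open>\<bar>F\<bar>\<^sup>2 / (\<xi> - l) = (\<xi> - l) \<bar>g\<bar>\<^sup>2\<close>, and the derivative of this function is \<open>2 Re (F' cnj g) - \<bar>g\<bar>\<^sup>2\<close>. Integration
  over \<open>[0, \<infinity>)\<close> gives
  \<open>\<bar>F 0\<bar>\<^sup>2 / \<bar>l\<bar> = \<integral> \<bar>g\<bar>\<^sup>2 - 2 Re \<integral> F' cnj g\<close> (\<open>half_line_boundary_identity\<close>).
  The first integral is \<open>2 pi \<integral> \<bar>\<phi>\<bar>\<^sup>2\<close> by Plancherel. In the second one \<open>F'\<close> is the transform of \<open>- i x u \<phi>\<close>, so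
  the integral equals \<open>- 2 pi i \<integral> x u \<bar>\<phi>\<bar>\<^sup>2\<close>, which is purely imaginary because \<open>u\<close> is real. Since
  \<open>F 0 = \<integral> u \<phi>\<close>, this is the claim.

  Little of the \<open>L\<^sup>2\<close> theory of the Fourier transform is needed, because all transforms that occur
  are given by the hypotheses. The function \<open>g = F / (\<xi> - l)\<close> is moreover integrable, so that inversion and
  Plancherel are needed only for integrable transforms. Everything rests on two facts. One is the duality
  \<open>\<integral> f (transform of h) = \<integral> (transform of f) h\<close> (\<open>fourier_transform_duality\<close>). The other is that an integrable
  function with vanishing transform is zero (\<open>AE_zero_if_transform_zero\<close>), which follows from
  Levy's uniqueness theorem for characteristic functions. Modulated Gaussians connect the two: they
  are closed under the Fourier transform, and pairing with them amounts to taking the transform of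
  the function times a Gaussian (\<open>AE_zero_if_gauss_orthogonal\<close>). Uniqueness, injectivity and inversion all follow by
  comparing such pairings.

  The weak derivative is defined by compactly supported test functions, so it has to be extended to
  Gaussians (\<open>weak_derivative_gaussian\<close>). This takes one smooth cutoff function, built from \<open>exp (- 1 / x)\<close>.
\<close>

section \<open>Measurability and integrability of products\<close>

lemma sigma_finite_lebesgue: "sigma_finite_measure (lebesgue :: real measure)"
proof
  let ?A = "range (\<lambda>n::nat. cball (0::real) (real n))"
  have "(\<Union>n::nat. cball (0::real) (real n)) = UNIV"
    by (auto simp: dist_norm intro: real_arch_simple)
  moreover have "\<forall>a\<in>?A. emeasure lebesgue a \<noteq> \<infinity>"
    by (auto simp: emeasure_lborel_cbox_eq emeasure_cball)
  ultimately show "\<exists>A. countable A \<and> A \<subseteq> sets (lebesgue::real measure) \<and> \<Union>A = space lebesgue \<and> (\<forall>a\<in>A. emeasure lebesgue a \<noteq> \<infinity>)"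
    by (intro exI[of _ ?A]) auto
qed

lemma borel_imp_lebesgue_measurable:
  "f \<in> borel_measurable borel \<Longrightarrow> f \<in> borel_measurable (lebesgue :: real measure)"
  by (metis measurable_completion sets_lborel measurable_cong_sets)

lemma L2_measurable: "f \<in> L2 \<Longrightarrow> f \<in> borel_measurable lebesgue"
  by (simp add: L2_def)

lemma integrable_mult_L2:
  fixes f g :: "real \<Rightarrow> complex"
  assumes f: "f \<in> L2" and g: "g \<in> L2"
  shows "integrable lebesgue (\<lambda>x. f x * g x)"
proof (rule Bochner_Integration.integrable_bound)
  show "integrable lebesgue (\<lambda>x. (cmod (f x))\<^sup>2 + (cmod (g x))\<^sup>2)"
    using f g by (auto simp: L2_def)
  have "cmod (f x * g x) \<le> (cmod (f x))\<^sup>2 + (cmod (g x))\<^sup>2" for x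
  proof -
    have "0 \<le> cmod (f x) * cmod (g x)" by simp
    then show ?thesis
      using sum_squares_bound[of "cmod (f x)" "cmod (g x)"] unfolding norm_mult mult.assoc by linarith
  qed
  then show "AE x in lebesgue. cmod (f x * g x) \<le> norm ((cmod (f x))\<^sup>2 + (cmod (g x))\<^sup>2)"
    by (auto intro!: AE_I2)
qed (use f g in \<open>auto dest!: L2_measurable\<close>)

lemma integrable_bounded_mult:
  fixes f :: "real \<Rightarrow> complex"
  assumes f: "integrable lebesgue f" and k: "k \<in> borel_measurable borel" "\<And>x. cmod (k x) \<le> C"
  shows "integrable lebesgue (\<lambda>x. k x * f x)"
proof (rule Bochner_Integration.integrable_bound)
  show "integrable lebesgue (\<lambda>x. C * cmod (f x))"
    using f by auto
  have [measurable]: "k \<in> borel_measurable lebesgue" using k borel_imp_lebesgue_measurable by blast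
  have [measurable]: "f \<in> borel_measurable lebesgue" using f by auto
  show "(\<lambda>x. k x * f x) \<in> borel_measurable lebesgue" by measurable
  have "C \<ge> 0" using k(2)[of 0] norm_ge_zero order_trans by blast
  then show "AE x in lebesgue. cmod (k x * f x) \<le> norm (C * cmod (f x))"
    using k(2) by (auto simp: norm_mult intro!: AE_I2 mult_right_mono)
qed

section \<open>Integrable functions with vanishing Fourier transform\<close>

text \<open>
  Split \<open>g = P - N\<close> into positive and negative part. The hypothesis at \<open>t = 0\<close> gives both the same
  mass \<open>m\<close>. If \<open>m > 0\<close>, then \<open>P / m\<close> and \<open>N / m\<close> are densities of probability measures with equal
  characteristic functions, so Levy's uniqueness theorem makes them equal.
\<close>

lemma AE_zero_if_real_transform_zero:
  fixes g :: "real \<Rightarrow> real"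
  assumes g: "integrable lborel g"
    and zero: "\<And>t. (LINT x|lborel. iexp (t * x) * of_real (g x)) = 0"
  shows "AE x in lborel. g x = 0"
proof -
  have gm[measurable]: "g \<in> borel_measurable borel" using g by auto
  define P where "P x = max 0 (g x)" for x
  define N where "N x = max 0 (- g x)" for x
  have g_eq: "g x = P x - N x" for x by (auto simp: P_def N_def)
  have nonneg: "0 \<le> P x" "0 \<le> N x" for x by (auto simp: P_def N_def)
  have PN[measurable]: "P \<in> borel_measurable borel" "N \<in> borel_measurable borel"
    by (auto simp: P_def[abs_def] N_def[abs_def])
  have intP: "integrable lborel P" and intN: "integrable lborel N"
    using g by (auto simp: P_def[abs_def] N_def[abs_def])
  have int_iexp: "integrable lborel (\<lambda>x. iexp (t * x) * of_real (f x))" if "integrable lborel f" for f t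
  proof (rule Bochner_Integration.integrable_bound[OF that])
    have "f \<in> borel_measurable borel" using that by auto
    then show "(\<lambda>x. iexp (t * x) * complex_of_real (f x)) \<in> borel_measurable lborel" by measurable
  qed (auto simp: norm_mult)
  have eq: "(LINT x|lborel. iexp (t * x) * of_real (P x)) = (LINT x|lborel. iexp (t * x) * of_real (N x))" for t
    using zero[of t] Bochner_Integration.integral_diff[OF int_iexp[OF intP] int_iexp[OF intN], of t t]
    by (simp add: g_eq algebra_simps)
  define m where "m = (LINT x|lborel. P x)"
  have mN: "m = (LINT x|lborel. N x)"
    using eq[of 0] by (simp add: m_def)
  show ?thesis
  proof (cases "m = 0")
    case True
    then have "AE x in lborel. P x = 0" "AE x in lborel. N x = 0"
      using integral_nonneg_eq_0_iff_AE[OF intP] integral_nonneg_eq_0_iff_AE[OF intN] nonneg mN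
      by (auto simp: m_def)
    then show ?thesis by eventually_elim (simp add: g_eq)
  next
    case False
    then have m: "m > 0" using nonneg(1) Bochner_Integration.integral_nonneg[of lborel P] by (auto simp: m_def less_le)
    have dist: "real_distribution (density lborel (\<lambda>x. ennreal (f x / m)))"
      if "integrable lborel f" "\<And>x. 0 \<le> f x" "(LINT x|lborel. f x) = m" for f
    proof -
      have [measurable]: "f \<in> borel_measurable borel" using that by auto
      have "(\<integral>\<^sup>+x. ennreal (f x / m) \<partial>lborel) = 1"
        using that m by (subst nn_integral_eq_integral) auto
      then have "prob_space (density lborel (\<lambda>x. ennreal (f x / m)))"
        by (intro prob_spaceI) (simp add: emeasure_density)
      then show ?thesis
        by (simp add: real_distribution_def real_distribution_axioms_def)
    qed
    have char: "char (density lborel (\<lambda>x. ennreal (f x / m))) t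
        = (LINT x|lborel. iexp (t * x) * of_real (f x)) / of_real m"
      if [measurable]: "f \<in> borel_measurable borel" and "\<And>x. 0 \<le> f x" for f t
      unfolding char_def using that(2) m
      by (subst integral_density) (auto simp: scaleR_conv_of_real mult_ac)
    have "density lborel (\<lambda>x. ennreal (P x / m)) = density lborel (\<lambda>x. ennreal (N x / m))"
      by (intro Levy_uniqueness dist intP intN nonneg ext)
         (simp_all only: m_def[symmetric] mN[symmetric] char[OF PN(1) nonneg(1)] char[OF PN(2) nonneg(2)] eq)
    then have "AE x in lborel. ennreal (P x / m) = ennreal (N x / m)"
      by (intro sigma_finite_measure.density_unique[OF lborel.sigma_finite_measure_axioms]) auto
    then show ?thesis
    proof eventually_elim
      case (elim x)
      then have "P x / m = N x / m" using m nonneg by (simp only: ennreal_inj divide_nonneg_pos)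
      then show ?case using m by (simp add: g_eq)
    qed
  qed
qed

text \<open>
  The hypothesis is invariant under conjugating \<open>G\<close> and reflecting \<open>t\<close>, hence it passes to the real
  and imaginary parts of \<open>G\<close>.
\<close>

lemma AE_zero_if_transform_zero:
  fixes G :: "real \<Rightarrow> complex"
  assumes G: "integrable lebesgue G"
    and zero: "\<And>t. (LINT x|lebesgue. iexp (t * x) * G x) = 0"
  shows "AE x in lebesgue. G x = 0"
proof -
  have iG: "integrable lebesgue (\<lambda>x. iexp (t * x) * G x)" for t
    by (rule integrable_bounded_mult[OF G, of _ 1]) auto
  have iGc: "integrable lebesgue (\<lambda>x. iexp (t * x) * cnj (G x))" for t
    by (rule integrable_bounded_mult[OF _, of _ _ 1]) (use G in auto)
  have zero': "(LINT x|lebesgue. iexp (t * x) * cnj (G x)) = 0" for t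
  proof -
    have "(LINT x|lebesgue. iexp (t * x) * cnj (G x)) = (LINT x|lebesgue. cnj (iexp ((-t) * x) * G x))"
      by (simp add: exp_cnj)
    also have "\<dots> = cnj (LINT x|lebesgue. iexp ((-t) * x) * G x)"
      by (rule Bochner_Integration.integral_cnj)
    finally show ?thesis by (simp only: zero complex_cnj_zero)
  qed
  have real: "AE x in lebesgue. f x = 0"
    if f: "integrable lebesgue f" and z: "\<And>t. (LINT x|lebesgue. iexp (t * x) * of_real (f x)) = 0" for f :: "real \<Rightarrow> real"
  proof -
    obtain f' where f': "f' \<in> borel_measurable lborel" "AE x in lborel. f x = f' x"
      using completion_ex_borel_measurable_real[of f lborel] f by auto
    have [measurable]: "f' \<in> borel_measurable borel" using f' by simp
    have ae: "AE x in lebesgue. f x = f' x" using f' by (simp add: AE_completion)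
    have [measurable]: "f' \<in> borel_measurable lebesgue" by (rule borel_imp_lebesgue_measurable) simp
    have [measurable]: "f \<in> borel_measurable lebesgue" using f by auto
    have "integrable lebesgue f'"
      using f ae by (subst integrable_cong_AE[of _ _ f]) auto
    then have i: "integrable lborel f'" by (subst (asm) integrable_completion) auto
    have "(LINT x|lborel. iexp (t * x) * of_real (f' x)) = 0" for t
    proof -
      have [measurable]: "(\<lambda>x. iexp (t * x)) \<in> borel_measurable lebesgue"
        by (rule borel_imp_lebesgue_measurable) measurable
      have "(LINT x|lborel. iexp (t * x) * of_real (f' x)) = (LINT x|lebesgue. iexp (t * x) * of_real (f' x))"
        by (subst integral_completion) auto
      also have "\<dots> = (LINT x|lebesgue. iexp (t * x) * of_real (f x))"
        proof (rule integral_cong_AE)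
        show "AE x in lebesgue. iexp (t * x) * complex_of_real (f' x) = iexp (t * x) * complex_of_real (f x)"
          using ae by eventually_elim simp
      qed measurable
      finally show ?thesis using z by simp
    qed
    from AE_zero_if_real_transform_zero[OF i this] have "AE x in lebesgue. f' x = 0"
      by (simp add: AE_completion)
    with ae show ?thesis by eventually_elim simp
  qed
  have "AE x in lebesgue. Re (G x) = 0"
  proof (rule real)
    show "integrable lebesgue (\<lambda>x. Re (G x))" using G by auto
    fix t
    have "(LINT x|lebesgue. iexp (t * x) * of_real (Re (G x)))
        = (LINT x|lebesgue. (iexp (t * x) * G x + iexp (t * x) * cnj (G x)) / 2)"
      by (intro Bochner_Integration.integral_cong refl) (simp add: ring_distribs[symmetric] complex_add_cnj)
    also have "\<dots> = 0"
      using Bochner_Integration.integral_add[OF iG iGc] zero zero' by simp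
    finally show "(LINT x|lebesgue. iexp (t * x) * of_real (Re (G x))) = 0" .
  qed
  moreover have "AE x in lebesgue. Im (G x) = 0"
  proof (rule real)
    show "integrable lebesgue (\<lambda>x. Im (G x))" using G by auto
    fix t
    have "(LINT x|lebesgue. iexp (t * x) * of_real (Im (G x)))
        = (LINT x|lebesgue. (iexp (t * x) * G x - iexp (t * x) * cnj (G x)) / (2 * \<i>))"
      by (intro Bochner_Integration.integral_cong refl) (simp add: complex_eq_iff Re_divide Im_divide power2_eq_square)
    also have "\<dots> = 0"
      using Bochner_Integration.integral_diff[OF iG iGc] zero zero' by simp
    finally show "(LINT x|lebesgue. iexp (t * x) * of_real (Im (G x))) = 0" .
  qed
  ultimately show ?thesis by eventually_elim (simp add: complex_eq_iff)
qed

section \<open>Fourier integrals and duality\<close>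

lemma fourier_integral_iexp:
  "fourier_integral f \<xi> = (LINT x|lebesgue. iexp (- \<xi> * x) * f x)"
  unfolding fourier_integral_def by (simp add: mult_ac)

lemma fourier_integrand_integrable:
  assumes "integrable lebesgue f"
  shows "integrable lebesgue (\<lambda>x. iexp (\<xi> * x) * f x)"
  by (rule integrable_bounded_mult[OF assms, of _ 1]) auto

lemma fourier_integral_bounded:
  assumes "integrable lebesgue f"
  shows "cmod (fourier_integral f \<xi>) \<le> (LINT x|lebesgue. cmod (f x))"
proof -
  have "cmod (fourier_integral f \<xi>) \<le> (LINT x|lebesgue. cmod (iexp (- \<xi> * x) * f x))"
    unfolding fourier_integral_iexp by (rule integral_norm_bound)
  then show ?thesis by (simp add: norm_mult)
qed

lemma fourier_integral_isCont:
  assumes f: "integrable lebesgue f"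
  shows "isCont (fourier_integral f) \<xi>"
  unfolding continuous_at_sequentially comp_def
proof (intro allI impI)
  fix X assume X: "X \<longlonglongrightarrow> \<xi>"
  show "(\<lambda>n. fourier_integral f (X n)) \<longlonglongrightarrow> fourier_integral f \<xi>"
    unfolding fourier_integral_iexp
  proof (rule integral_dominated_convergence)
    show "integrable lebesgue (\<lambda>x. cmod (f x))" using f by auto
    show "(\<lambda>x. iexp (- X n * x) * f x) \<in> borel_measurable lebesgue" for n
      by (rule borel_measurable_integrable[OF fourier_integrand_integrable[OF f]])
    show "(\<lambda>x. iexp (- \<xi> * x) * f x) \<in> borel_measurable lebesgue"
      by (rule borel_measurable_integrable[OF fourier_integrand_integrable[OF f]])
    show "AE x in lebesgue. (\<lambda>n. iexp (- X n * x) * f x) \<longlonglongrightarrow> iexp (- \<xi> * x) * f x"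
      by (intro AE_I2 tendsto_intros X)
    show "AE x in lebesgue. cmod (iexp (- X n * x) * f x) \<le> cmod (f x)" for n
      by (intro AE_I2) (simp add: norm_mult del: of_real_mult of_real_minus)
  qed
qed

lemma fourier_integral_measurable:
  assumes "integrable lebesgue f"
  shows "fourier_integral f \<in> borel_measurable borel"
  by (intro borel_measurable_continuous_onI continuous_at_imp_continuous_on ballI
      fourier_integral_isCont assms)

lemma has_vector_derivative_iff_quotient:
  "(f has_vector_derivative D) (at x) \<longleftrightarrow> ((\<lambda>h. (f (x + h) - f x) /\<^sub>R h) \<longlongrightarrow> D) (at (0::real))"
proof -
  have "((\<lambda>h. (f (x + h) - f x) /\<^sub>R h) \<longlongrightarrow> D) (at 0) \<longleftrightarrow> ((\<lambda>h. norm ((f (x + h) - f x) /\<^sub>R h - D)) \<longlongrightarrow> 0) (at 0)"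
    by (simp add: tendsto_norm_zero_iff LIM_zero_iff)
  also have "\<dots> \<longleftrightarrow> ((\<lambda>h. norm (f (x + h) - f x - h *\<^sub>R D) / norm h) \<longlongrightarrow> 0) (at 0)"
  proof (rule filterlim_cong[OF refl refl], rule eventually_at_filter[THEN iffD2], rule always_eventually, intro allI impI)
    fix h :: real assume h: "h \<noteq> 0"
    then have "(f (x + h) - f x) /\<^sub>R h - D = (f (x + h) - f x - h *\<^sub>R D) /\<^sub>R h"
      by (simp add: scaleR_diff_right)
    then show "norm ((f (x + h) - f x) /\<^sub>R h - D) = norm (f (x + h) - f x - h *\<^sub>R D) / norm h"
      by (simp add: divide_inverse mult.commute)
  qed
  finally show ?thesis
    by (simp add: has_vector_derivative_def has_derivative_at bounded_linear_scaleR_left)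
qed

text \<open>
  Differentiation under the integral: by \<open>\<bar>exp (i y) - 1\<bar> \<le> \<bar>y\<bar>\<close> the difference quotients of the integrand
  are dominated by \<open>\<bar>x f x\<bar>\<close>.
\<close>

lemma fourier_integral_has_derivative:
  fixes f :: "real \<Rightarrow> complex"
  assumes f: "integrable lebesgue f" and xf: "integrable lebesgue (\<lambda>x. of_real x * f x)"
  shows "(fourier_integral f has_vector_derivative
           fourier_integral (\<lambda>x. - \<i> * (of_real x * f x)) \<xi>) (at \<xi>)"
proof -
  have "((\<lambda>h. (fourier_integral f (\<xi> + h) - fourier_integral f \<xi>) /\<^sub>R h) \<longlongrightarrow>
           fourier_integral (\<lambda>x. - \<i> * (of_real x * f x)) \<xi>) (at 0)"
    unfolding tendsto_at_iff_sequentially comp_def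
  proof (intro allI impI)
    fix X :: "nat \<Rightarrow> real" assume X0: "\<forall>i. X i \<in> UNIV - {0}" and X: "X \<longlonglongrightarrow> 0"
    then have X1: "X i \<noteq> 0" for i by blast
    have eq: "(fourier_integral f (\<xi> + X n) - fourier_integral f \<xi>) /\<^sub>R X n =
      (LINT x|lebesgue. ((iexp (- (\<xi> + X n) * x) - iexp (- \<xi> * x)) /\<^sub>R X n) * f x)" for n
    proof -
      have "(LINT x|lebesgue. ((iexp (- (\<xi> + X n) * x) - iexp (- \<xi> * x)) /\<^sub>R X n) * f x)
        = (LINT x|lebesgue. (iexp (- (\<xi> + X n) * x) * f x - iexp (- \<xi> * x) * f x) /\<^sub>R X n)"
        by (intro Bochner_Integration.integral_cong refl) (simp add: left_diff_distrib del: of_real_mult of_real_minus of_real_add)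
      also have "\<dots> = (LINT x|lebesgue. iexp (- (\<xi> + X n) * x) * f x - iexp (- \<xi> * x) * f x) /\<^sub>R X n"
        by (rule integral_scaleR_right) 
      also have "\<dots> = (fourier_integral f (\<xi> + X n) - fourier_integral f \<xi>) /\<^sub>R X n"
        unfolding fourier_integral_iexp
        by (subst Bochner_Integration.integral_diff[OF fourier_integrand_integrable[OF f] fourier_integrand_integrable[OF f]]) (rule refl)
      finally show ?thesis by (rule sym)
    qed
    have fm[measurable]: "f \<in> borel_measurable lebesgue" using f by auto
    have em[measurable]: "(\<lambda>x. iexp (c * x)) \<in> borel_measurable lebesgue" for c
      by (rule borel_imp_lebesgue_measurable) measurable
    show "(\<lambda>n. (fourier_integral f (\<xi> + X n) - fourier_integral f \<xi>) /\<^sub>R X n)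
        \<longlonglongrightarrow> fourier_integral (\<lambda>x. - \<i> * (of_real x * f x)) \<xi>"
      unfolding eq unfolding fourier_integral_iexp
    proof (rule integral_dominated_convergence)
      show "integrable lebesgue (\<lambda>x. cmod (of_real x * f x))" using xf by auto
      show "(\<lambda>x. ((iexp (- (\<xi> + X n) * x) - iexp (- \<xi> * x)) /\<^sub>R X n) * f x) \<in> borel_measurable lebesgue" for n
        by measurable
      have [measurable]: "(\<lambda>x. of_real x * f x) \<in> borel_measurable lebesgue" using xf by auto
      show "(\<lambda>x. iexp (- \<xi> * x) * (- \<i> * (of_real x * f x))) \<in> borel_measurable lebesgue"
        by measurable
      show "AE x in lebesgue. (\<lambda>n. ((iexp (- (\<xi> + X n) * x) - iexp (- \<xi> * x)) /\<^sub>R X n) * f x)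
          \<longlonglongrightarrow> iexp (- \<xi> * x) * (- \<i> * (of_real x * f x))"
      proof (rule AE_I2)
        fix x :: real
        have "((\<lambda>y. iexp (- y * x)) has_vector_derivative (iexp (- \<xi> * x) * (- \<i> * of_real x))) (at \<xi>)"
        proof -
          have "((\<lambda>z. exp (z * (- \<i> * of_real x))) has_field_derivative
              exp (of_real \<xi> * (- \<i> * of_real x)) * (- \<i> * of_real x)) (at (of_real \<xi>))"
            by (auto intro!: derivative_eq_intros)
          from has_vector_derivative_real_field[OF this, of UNIV] show ?thesis
            by (simp add: mult_ac)
        qed
        then have "((\<lambda>h. (iexp (- (\<xi> + h) * x) - iexp (- \<xi> * x)) /\<^sub>R h) \<longlongrightarrow> iexp (- \<xi> * x) * (- \<i> * of_real x)) (at 0)"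
          by (simp only: has_vector_derivative_iff_quotient)
        then have "(\<lambda>n. (iexp (- (\<xi> + X n) * x) - iexp (- \<xi> * x)) /\<^sub>R X n) \<longlonglongrightarrow> iexp (- \<xi> * x) * (- \<i> * of_real x)"
          using X X1 unfolding tendsto_at_iff_sequentially comp_def by blast
        from tendsto_mult[OF this tendsto_const[of "f x"]]
        show "(\<lambda>n. ((iexp (- (\<xi> + X n) * x) - iexp (- \<xi> * x)) /\<^sub>R X n) * f x)
          \<longlonglongrightarrow> iexp (- \<xi> * x) * (- \<i> * (of_real x * f x))"
          by (simp only: mult.assoc)
      qed
      show "AE x in lebesgue. cmod (((iexp (- (\<xi> + X n) * x) - iexp (- \<xi> * x)) /\<^sub>R X n) * f x) \<le> cmod (of_real x * f x)" for n
      proof (rule AE_I2)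
        fix x :: real
        have "iexp (- (\<xi> + X n) * x) - iexp (- \<xi> * x) = iexp (- \<xi> * x) * (iexp (- X n * x) - 1)"
          by (simp add: algebra_simps exp_add[symmetric])
        then have "cmod (iexp (- (\<xi> + X n) * x) - iexp (- \<xi> * x)) = cmod (iexp (- X n * x) - 1)"
          by (simp add: norm_mult del: of_real_mult of_real_minus)
        also have "\<dots> \<le> \<bar>X n\<bar> * \<bar>x\<bar>"
          using iexp_approx1[of "- X n * x" 0] by (simp add: abs_mult)
        finally have le: "cmod (iexp (- (\<xi> + X n) * x) - iexp (- \<xi> * x)) \<le> \<bar>X n\<bar> * \<bar>x\<bar>" .
        have "cmod ((iexp (- (\<xi> + X n) * x) - iexp (- \<xi> * x)) /\<^sub>R X n)
            = inverse \<bar>X n\<bar> * cmod (iexp (- (\<xi> + X n) * x) - iexp (- \<xi> * x))"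
          by (simp only: norm_scaleR abs_inverse)
        also have "\<dots> \<le> inverse \<bar>X n\<bar> * (\<bar>X n\<bar> * \<bar>x\<bar>)"
          using le by (intro mult_left_mono) auto
        also have "\<dots> = \<bar>x\<bar>" using X1[of n] by simp
        finally have "cmod ((iexp (- (\<xi> + X n) * x) - iexp (- \<xi> * x)) /\<^sub>R X n) \<le> \<bar>x\<bar>" .
        from mult_right_mono[OF this norm_ge_zero[of "f x"]] show "cmod (((iexp (- (\<xi> + X n) * x) - iexp (- \<xi> * x)) /\<^sub>R X n) * f x) \<le> cmod (of_real x * f x)"
          by (simp only: norm_mult norm_of_real)
      qed
    qed
  qed
  then show ?thesis
    by (simp only: has_vector_derivative_iff_quotient)
qed

lemma fourier_integral_multiplication:
  assumes f: "integrable lebesgue f" and h: "integrable lebesgue h"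
  shows "(LINT x|lebesgue. f x * fourier_integral h x) = (LINT \<xi>|lebesgue. fourier_integral f \<xi> * h \<xi>)"
proof -
  interpret pair_sigma_finite "lebesgue :: real measure" "lebesgue :: real measure"
    using sigma_finite_lebesgue by (simp add: pair_sigma_finite_def)
  have [measurable]: "f \<in> borel_measurable lebesgue" "h \<in> borel_measurable lebesgue" using f h by auto
  have id[measurable]: "(\<lambda>x. x) \<in> measurable lebesgue (borel :: real measure)"
    by (rule borel_imp_lebesgue_measurable) simp
  have int: "integrable (lebesgue \<Otimes>\<^sub>M lebesgue) (\<lambda>(x, \<xi>). iexp (- \<xi> * x) * (f x * h \<xi>))"
  proof (rule Fubini_integrable)
    have e: "(\<lambda>(x, \<xi>). iexp (- \<xi> * x)) \<in> borel_measurable (borel \<Otimes>\<^sub>M borel)"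
      by measurable
    have m: "(\<lambda>z. (fst z, snd z)) \<in> measurable ((lebesgue :: real measure) \<Otimes>\<^sub>M (lebesgue :: real measure)) ((borel :: real measure) \<Otimes>\<^sub>M (borel :: real measure))"
      by (intro measurable_Pair measurable_compose[OF measurable_fst id] measurable_compose[OF measurable_snd id])
    have "(\<lambda>z. iexp (- snd z * fst z)) \<in> borel_measurable (lebesgue \<Otimes>\<^sub>M lebesgue)"
      using measurable_compose[OF m e] by simp
    moreover have "(\<lambda>z. f (fst z)) \<in> borel_measurable (lebesgue \<Otimes>\<^sub>M lebesgue)" "(\<lambda>z. h (snd z)) \<in> borel_measurable (lebesgue \<Otimes>\<^sub>M lebesgue)"
      by measurable
    ultimately show "(\<lambda>(x, \<xi>). iexp (- \<xi> * x) * (f x * h \<xi>)) \<in> borel_measurable (lebesgue \<Otimes>\<^sub>M lebesgue)"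
      unfolding case_prod_beta by (intro borel_measurable_times)
    have "(\<lambda>x. LINT y|lebesgue. norm (case (x, y) of (x, \<xi>) \<Rightarrow> iexp (- \<xi> * x) * (f x * h \<xi>)))
       = (\<lambda>x. cmod (f x) * (LINT y|lebesgue. cmod (h y)))"
      by (simp add: norm_mult del: of_real_mult of_real_minus)
    then show "integrable lebesgue (\<lambda>x. LINT y|lebesgue. norm (case (x, y) of (x, \<xi>) \<Rightarrow> iexp (- \<xi> * x) * (f x * h \<xi>)))"
      using f by simp
    show "AE x in lebesgue. integrable lebesgue (\<lambda>y. case (x, y) of (x, \<xi>) \<Rightarrow> iexp (- \<xi> * x) * (f x * h \<xi>))"
    proof (rule AE_I2)
      fix x
      have "integrable lebesgue (\<lambda>\<xi>. f x * (iexp ((- x) * \<xi>) * h \<xi>))"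
        by (intro integrable_mult_right impI fourier_integrand_integrable h)
      then show "integrable lebesgue (\<lambda>y. case (x, y) of (x, \<xi>) \<Rightarrow> iexp (- \<xi> * x) * (f x * h \<xi>))"
        by (simp add: mult_ac)
    qed
  qed
  have "(LINT x|lebesgue. f x * fourier_integral h x) = (LINT x|lebesgue. LINT \<xi>|lebesgue. iexp (- \<xi> * x) * (f x * h \<xi>))"
    unfolding fourier_integral_iexp
    by (subst integral_mult_right_zero[symmetric]) (simp add: mult_ac)
  also have "\<dots> = (LINT \<xi>|lebesgue. LINT x|lebesgue. iexp (- \<xi> * x) * (f x * h \<xi>))"
    using Fubini_integral[OF int] by simp
  also have "\<dots> = (LINT \<xi>|lebesgue. fourier_integral f \<xi> * h \<xi>)"
    unfolding fourier_integral_iexp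
    by (subst integral_mult_left_zero[symmetric]) (simp add: mult_ac)
  finally show ?thesis .
qed

lemma L2_iff_nn_integral_finite:
  assumes "f \<in> borel_measurable lebesgue"
  shows "f \<in> L2 \<longleftrightarrow> (\<integral>\<^sup>+x. ennreal ((norm (f x))\<^sup>2) \<partial>lebesgue) < \<infinity>"
  using assms by (auto simp: L2_def integrable_iff_bounded)

lemma indicator_L2: "(\<lambda>x. indicator {-R..R} x :: complex) \<in> L2"
proof -
  have "integrable lebesgue (\<lambda>x. indicator {-R..R} x :: real)"
    by (auto simp: integrable_indicator_iff emeasure_lborel_Icc_eq)
  moreover have "(norm (indicator {-R..R} x :: complex))\<^sup>2 = indicator {-R..R} x" for x
    by (auto simp: indicator_def)
  moreover have "(\<lambda>x. indicator {-R..R} x :: complex) \<in> borel_measurable lebesgue"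
    by (rule borel_imp_lebesgue_measurable) measurable
  ultimately show ?thesis
    by (simp add: L2_def)
qed

text \<open>
  The only link used below between the \<open>L\<^sup>2\<close> transform and ordinary integrals. For the truncations of \<open>f\<close>
  it is the multiplication formula above. As the truncation is removed, the left side converges by
  dominated convergence and the right side because the transforms converge in \<open>L\<^sup>2\<close> and \<open>h \<in> L\<^sup>2\<close>.
\<close>

lemma fourier_transform_duality:
  assumes FT: "has_fourier_transform f g"
    and h: "integrable lebesgue h" "h \<in> L2"
    and fh: "integrable lebesgue (\<lambda>x. f x * fourier_integral h x)"
  shows "(LINT x|lebesgue. f x * fourier_integral h x) = (LINT \<xi>|lebesgue. g \<xi> * h \<xi>)"
proof -
  define fR where "fR R x = indicator {-R..R} x * f x" for R :: real and x
  have f: "f \<in> L2" and g: "g \<in> L2" using FT by (auto simp: has_fourier_transform_def)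
  have [measurable]: "f \<in> borel_measurable lebesgue" "g \<in> borel_measurable lebesgue" "h \<in> borel_measurable lebesgue"
    using f g h by (auto dest: L2_measurable)
  have fR: "integrable lebesgue (fR R)" for R
    unfolding fR_def[abs_def] by (rule integrable_mult_L2[OF indicator_L2 f])
  define c where "c R = (LINT x|lebesgue. fR R x * fourier_integral h x)" for R
  have c: "c R = (LINT \<xi>|lebesgue. fourier_integral (fR R) \<xi> * h \<xi>)" for R
    unfolding c_def by (rule fourier_integral_multiplication[OF fR h(1)])
  have hm[measurable]: "fourier_integral h \<in> borel_measurable lebesgue"
    by (rule borel_imp_lebesgue_measurable[OF fourier_integral_measurable[OF h(1)]])
  have ind[measurable]: "(\<lambda>x. indicator {-R..R} x :: complex) \<in> borel_measurable lebesgue" for R :: real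
    by (rule borel_imp_lebesgue_measurable) measurable
  have "(c \<longlongrightarrow> (LINT x|lebesgue. f x * fourier_integral h x)) at_top"
    unfolding c_def[abs_def]
  proof (rule integral_dominated_convergence_at_top)
    show "integrable lebesgue (\<lambda>x. cmod (f x * fourier_integral h x))" using fh by auto
    show "(\<lambda>x. fR R x * fourier_integral h x) \<in> borel_measurable lebesgue" for R
      unfolding fR_def by measurable
    show "\<forall>\<^sub>F R in at_top. AE x in lebesgue. cmod (fR R x * fourier_integral h x) \<le> cmod (f x * fourier_integral h x)"
      by (intro always_eventually allI AE_I2) (auto simp: fR_def norm_mult indicator_def)
    show "AE x in lebesgue. ((\<lambda>R. fR R x * fourier_integral h x) \<longlongrightarrow> f x * fourier_integral h x) at_top"
    proof (rule AE_I2)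
      fix x
      have "\<forall>\<^sub>F R in at_top. fR R x * fourier_integral h x = f x * fourier_integral h x"
        using eventually_ge_at_top[of "\<bar>x\<bar>"] by eventually_elim (auto simp: fR_def indicator_def)
      then show "((\<lambda>R. fR R x * fourier_integral h x) \<longlongrightarrow> f x * fourier_integral h x) at_top"
        by (rule tendsto_eventually)
    qed
  qed (use fh in auto)
  moreover have "(c \<longlongrightarrow> (LINT \<xi>|lebesgue. g \<xi> * h \<xi>)) at_top"
  proof (rule tendstoI)
    fix e :: real assume e: "e > 0"
    define d where "d R \<xi> = fourier_integral (fR R) \<xi> - g \<xi>" for R \<xi>
    define H where "H = (LINT \<xi>|lebesgue. (cmod (h \<xi>))\<^sup>2)"
    have H: "H \<ge> 0" unfolding H_def by (rule Bochner_Integration.integral_nonneg) simp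
    \<comment> \<open>In place of the Cauchy--Schwarz inequality: \<open>\<bar>d h\<bar> \<le> \<bar>d\<bar>\<^sup>2 / t + t \<bar>h\<bar>\<^sup>2\<close>, with \<open>t\<close> so small that the
      second term integrates to less than \<open>e / 2\<close>.\<close>
    define t where "t = e / (2 * (H + 1))"
    have t: "t > 0" "t * H < e / 2" using e H by (auto simp: t_def field_simps)
    have FRm[measurable]: "fourier_integral (fR R) \<in> borel_measurable lebesgue" for R
      by (rule borel_imp_lebesgue_measurable[OF fourier_integral_measurable[OF fR]])
    have dm[measurable]: "d R \<in> borel_measurable lebesgue" for R
      unfolding d_def[abs_def] by measurable
    have "((\<lambda>R. \<integral>\<^sup>+\<xi>. ennreal ((cmod (d R \<xi>))\<^sup>2) \<partial>lebesgue) \<longlongrightarrow> 0) at_top"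
      using FT unfolding has_fourier_transform_def d_def fR_def by simp
    then have "\<forall>\<^sub>F R in at_top. (\<integral>\<^sup>+\<xi>. ennreal ((cmod (d R \<xi>))\<^sup>2) \<partial>lebesgue) < ennreal (t * e / 2)"
      by (rule order_tendstoD) (use t e in simp)
    then show "\<forall>\<^sub>F R in at_top. dist (c R) (LINT \<xi>|lebesgue. g \<xi> * h \<xi>) < e"
    proof eventually_elim
      case (elim R)
      then have d: "d R \<in> L2"
        by (subst L2_iff_nn_integral_finite) (auto elim: less_trans)
      then have id: "integrable lebesgue (\<lambda>\<xi>. (cmod (d R \<xi>))\<^sup>2)" by (simp add: L2_def)
      have small: "(LINT \<xi>|lebesgue. (cmod (d R \<xi>))\<^sup>2) < t * e / 2"
        using elim nn_integral_eq_integral[OF id] t e by (simp add: ennreal_less_iff)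
      have ih: "integrable lebesgue (\<lambda>\<xi>. (cmod (h \<xi>))\<^sup>2)" using h by (simp add: L2_def)
      have "c R - (LINT \<xi>|lebesgue. g \<xi> * h \<xi>) = (LINT \<xi>|lebesgue. d R \<xi> * h \<xi>)"
      proof -
        have "integrable lebesgue (\<lambda>\<xi>. fourier_integral (fR R) \<xi> * h \<xi>)"
          using integrable_bounded_mult[OF h(1) fourier_integral_measurable[OF fR] fourier_integral_bounded[OF fR]] .
        from Bochner_Integration.integral_diff[OF this integrable_mult_L2[OF g h(2)]]
        show ?thesis by (simp add: c d_def left_diff_distrib)
      qed
      then have "dist (c R) (LINT \<xi>|lebesgue. g \<xi> * h \<xi>) = cmod (LINT \<xi>|lebesgue. d R \<xi> * h \<xi>)"
        by (simp add: dist_norm)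
      also have "\<dots> \<le> (LINT \<xi>|lebesgue. cmod (d R \<xi> * h \<xi>))"
        by (rule integral_norm_bound)
      also have "\<dots> \<le> (LINT \<xi>|lebesgue. (cmod (d R \<xi>))\<^sup>2 / t + t * (cmod (h \<xi>))\<^sup>2)"
      proof (rule integral_mono)
        show "integrable lebesgue (\<lambda>\<xi>. cmod (d R \<xi> * h \<xi>))"
          using integrable_mult_L2[OF d h(2)] by auto
        show "integrable lebesgue (\<lambda>\<xi>. (cmod (d R \<xi>))\<^sup>2 / t + t * (cmod (h \<xi>))\<^sup>2)"
          using id ih by auto
        fix \<xi>
        let ?a = "cmod (d R \<xi>)" and ?b = "cmod (h \<xi>)"
        have "0 \<le> (?a - t * ?b)\<^sup>2 + ?a * (t * ?b)" using t by simp
        also have "\<dots> = ?a\<^sup>2 - ?a * (t * ?b) + (t * ?b)\<^sup>2" by (simp add: power2_eq_square algebra_simps)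
        finally have "t * (?a * ?b) \<le> ?a\<^sup>2 + t * (t * ?b\<^sup>2)" by (simp add: power2_eq_square algebra_simps)
        then show "cmod (d R \<xi> * h \<xi>) \<le> ?a\<^sup>2 / t + t * ?b\<^sup>2"
          using t by (simp add: norm_mult field_simps power2_eq_square)
      qed
      also have "\<dots> = (LINT \<xi>|lebesgue. (cmod (d R \<xi>))\<^sup>2) / t + t * H"
        using id ih by (simp add: H_def)
      also have "\<dots> < e / 2 + e / 2"
        using small t by (intro add_strict_mono) (simp_all add: field_simps)
      finally show ?case by simp
    qed
  qed
  ultimately show ?thesis
    using tendsto_unique trivial_limit_at_top_linorder by blast
qed

section \<open>Gaussians as a separating family\<close>

text \<open>
  Gaussians centred at \<open>b\<close> with a modulation of frequency \<open>a\<close>. The family is mapped to itself by the Fourier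
  transform, with \<open>a\<close> and \<open>b\<close> exchanged up to sign. Hence the duality formula with these functions
  translates statements about a function into statements about its transform.
\<close>

definition gauss :: "real \<Rightarrow> real \<Rightarrow> real \<Rightarrow> complex" where
  "gauss a b x = iexp (a * x) * of_real (exp (- (x - b)\<^sup>2 / 2))"

lemma integrable_Gaussian_moment:
  "integrable lebesgue (\<lambda>x::real. (x - b) ^ k * exp (- (x - b)\<^sup>2 / 2))"
proof -
  have "integrable lborel (\<lambda>x. sqrt (2 * pi) * (normal_density b 1 x * (x - b) ^ k))"
    by (intro integrable_mult_right impI integrable_normal_moment) simp
  then have "integrable lborel (\<lambda>x::real. (x - b) ^ k * exp (- (x - b)\<^sup>2 / 2))"
    by (simp add: normal_density_def mult_ac)
  then show ?thesis
    by (subst integrable_completion) auto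
qed

lemma gauss_measurable: "gauss a b \<in> borel_measurable borel"
  unfolding gauss_def[abs_def] by measurable

lemma norm_gauss: "cmod (gauss a b x) = exp (- (x - b)\<^sup>2 / 2)"
  by (simp add: gauss_def norm_mult del: of_real_mult of_real_power of_real_diff)

lemma gauss_moment_measurable:
  "(\<lambda>x. of_real ((x - b) ^ k) * gauss a b x) \<in> borel_measurable lebesgue"
proof (rule borel_imp_lebesgue_measurable)
  have [measurable]: "gauss a b \<in> borel_measurable borel" by (rule gauss_measurable)
  show "(\<lambda>x. of_real ((x - b) ^ k) * gauss a b x) \<in> borel_measurable borel" by measurable
qed

lemma gauss_moment_integrable:
  "integrable lebesgue (\<lambda>x. of_real ((x - b) ^ k) * gauss a b x)"
  by (rule Bochner_Integration.integrable_bound[OF integrable_Gaussian_moment[of b k] gauss_moment_measurable])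
     (simp add: norm_mult norm_gauss abs_mult del: of_real_power of_real_diff)

lemma gauss_moment_L2: "(\<lambda>x. of_real ((x - b) ^ k) * gauss a b x) \<in> L2"
proof -
  have "integrable lebesgue (\<lambda>x. (cmod (of_real ((x - b) ^ k) * gauss a b x))\<^sup>2)"
  proof (rule Bochner_Integration.integrable_bound[OF integrable_Gaussian_moment[of b "2 * k"]])
    have [measurable]: "(\<lambda>x. of_real ((x - b) ^ k) * gauss a b x) \<in> borel_measurable lebesgue"
      by (rule gauss_moment_measurable)
    show "(\<lambda>x. (cmod (of_real ((x - b) ^ k) * gauss a b x))\<^sup>2) \<in> borel_measurable lebesgue"
      by measurable
    show "AE x in lebesgue. norm ((cmod (of_real ((x - b) ^ k) * gauss a b x))\<^sup>2)
        \<le> norm ((x - b) ^ (2 * k) * exp (- (x - b)\<^sup>2 / 2))"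
    proof (rule AE_I2)
      fix x
      have "(exp (- (x - b)\<^sup>2 / 2))\<^sup>2 \<le> exp (- (x - b)\<^sup>2 / 2)"
        using mult_left_mono[of "exp (- (x - b)\<^sup>2 / 2)" 1 "exp (- (x - b)\<^sup>2 / 2)"]
        by (simp add: power2_eq_square)
      then have "((x - b) ^ k)\<^sup>2 * (exp (- (x - b)\<^sup>2 / 2))\<^sup>2 \<le> ((x - b) ^ k)\<^sup>2 * exp (- (x - b)\<^sup>2 / 2)"
        by (rule mult_left_mono) simp
      then show "norm ((cmod (of_real ((x - b) ^ k) * gauss a b x))\<^sup>2)
        \<le> norm ((x - b) ^ (2 * k) * exp (- (x - b)\<^sup>2 / 2))"
        by (simp add: norm_mult norm_gauss power_mult_distrib abs_mult mult.commute[of 2] power_mult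
            del: of_real_power of_real_diff)
    qed
  qed
  then show ?thesis
    unfolding L2_def using gauss_moment_measurable[of b k a] by blast
qed

lemmas gauss_integrable = gauss_moment_integrable[where k = 0, simplified]
lemmas gauss_L2 = gauss_moment_L2[where k = 0, simplified]

text \<open>
  Shift the variable to the centre \<open>b\<close>; what remains is the characteristic function of the standard normal
  distribution.
\<close>

lemma fourier_integral_gauss:
  "fourier_integral (gauss a b) x = of_real (sqrt (2 * pi)) * iexp (a * b) * gauss (- b) a x"
proof -
  have std: "(LINT y|lborel. iexp (t * y) * of_real (exp (- y\<^sup>2 / 2))) = of_real (sqrt (2 * pi)) * of_real (exp (- t\<^sup>2 / 2))" for t
  proof -
    have "of_real (exp (- t\<^sup>2 / 2)) = char std_normal_distribution t"
      by (simp add: char_std_normal_distribution)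
    also have "\<dots> = (LINT y|lborel. std_normal_density y *\<^sub>R iexp (t * y))"
      unfolding char_def by (subst integral_density) auto
    also have "\<dots> = (LINT y|lborel. (iexp (t * y) * of_real (exp (- y\<^sup>2 / 2))) / of_real (sqrt (2 * pi)))"
      by (intro Bochner_Integration.integral_cong refl)
         (simp only: std_normal_density_def scaleR_conv_of_real of_real_mult of_real_divide of_real_1
            times_divide_eq_left mult_1_left mult.commute[of "exp (\<i> * _)"])
    also have "\<dots> = (LINT y|lborel. iexp (t * y) * of_real (exp (- y\<^sup>2 / 2))) / of_real (sqrt (2 * pi))"
      by (rule Bochner_Integration.integral_divide_zero)
    finally show ?thesis by (simp add: field_simps)
  qed
  have [measurable]: "gauss a b \<in> borel_measurable borel" by (rule gauss_measurable)
  have "fourier_integral (gauss a b) x = (LINT \<xi>|lborel. iexp (- x * \<xi>) * gauss a b \<xi>)"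
    unfolding fourier_integral_iexp by (subst integral_completion) auto
  also have "\<dots> = (LINT y|lborel. iexp (- x * (b + y)) * gauss a b (b + y))"
    by (subst lborel_integral_real_affine[where c = 1 and t = b]) auto
  also have "\<dots> = (LINT y|lborel. iexp ((a - x) * b) * (iexp ((a - x) * y) * of_real (exp (- y\<^sup>2 / 2))))"
  proof (intro Bochner_Integration.integral_cong refl)
    fix y
    have "iexp (- x * (b + y)) * iexp (a * (b + y)) = iexp ((a - x) * b) * iexp ((a - x) * y)"
      by (simp only: exp_add[symmetric] distrib_left[symmetric] of_real_add[symmetric])
         (rule arg_cong[where f = "\<lambda>z. iexp z"], simp add: algebra_simps)
    then show "iexp (- x * (b + y)) * gauss a b (b + y)
        = iexp ((a - x) * b) * (iexp ((a - x) * y) * of_real (exp (- y\<^sup>2 / 2)))"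
      unfolding gauss_def mult.assoc[symmetric] by simp
  qed
  also have "\<dots> = iexp ((a - x) * b) * (LINT y|lborel. iexp ((a - x) * y) * of_real (exp (- y\<^sup>2 / 2)))"
    by (rule integral_mult_right_zero)
  also have "\<dots> = iexp ((a - x) * b) * (of_real (sqrt (2 * pi)) * of_real (exp (- (a - x)\<^sup>2 / 2)))"
    by (simp only: std)
  also have "\<dots> = of_real (sqrt (2 * pi)) * (iexp ((a - x) * b) * of_real (exp (- (x - a)\<^sup>2 / 2)))"
    by (simp only: power2_commute[of a x] mult.left_commute)
  also have "iexp ((a - x) * b) = iexp (a * b) * iexp (- b * x)"
    by (simp only: exp_add[symmetric] distrib_left[symmetric] of_real_add[symmetric])
       (rule arg_cong[where f = "\<lambda>z. iexp z"], simp add: algebra_simps)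
  finally show ?thesis by (simp only: gauss_def[of "- b" a x] mult.assoc)
qed

text \<open>
  Differentiate the transform of \<open>gauss a 0\<close> in two ways: under the integral sign, and in closed form.
  This says that the transform of \<open>- i \<xi> gauss a 0 \<xi>\<close> is the derivative of a translated Gaussian.
\<close>

lemma fourier_integral_moment_gauss:
  "fourier_integral (\<lambda>\<xi>. - \<i> * (of_real \<xi> * gauss a 0 \<xi>)) x
     = of_real (sqrt (2 * pi)) * of_real (- (x - a) * exp (- (x - a)\<^sup>2 / 2))"
proof -
  have m: "integrable lebesgue (\<lambda>x. of_real x * gauss a 0 x)"
    using gauss_moment_integrable[of 0 1 a] by simp
  have "(fourier_integral (gauss a 0) has_vector_derivative
           fourier_integral (\<lambda>x. - \<i> * (of_real x * gauss a 0 x)) x) (at x)"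
    by (rule fourier_integral_has_derivative[OF gauss_integrable m])
  moreover have "fourier_integral (gauss a 0) = (\<lambda>x. of_real (sqrt (2 * pi)) * of_real (exp (- (x - a)\<^sup>2 / 2)))"
    by (rule ext) (simp add: fourier_integral_gauss gauss_def del: of_real_power of_real_diff)
  ultimately have "((\<lambda>x. of_real (sqrt (2 * pi)) * of_real (exp (- (x - a)\<^sup>2 / 2))) has_vector_derivative
           fourier_integral (\<lambda>x. - \<i> * (of_real x * gauss a 0 x)) x) (at x)"
    by simp
  moreover have "((\<lambda>x. of_real (sqrt (2 * pi)) * of_real (exp (- (x - a)\<^sup>2 / 2))) has_vector_derivative
     of_real (sqrt (2 * pi)) * complex_of_real (- (x - a) * exp (- (x - a)\<^sup>2 / 2))) (at x)"
  proof -
    have "((\<lambda>x. exp (- (x - a)\<^sup>2 / 2)) has_real_derivative - (x - a) * exp (- (x - a)\<^sup>2 / 2)) (at x)"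
      by (auto intro!: derivative_eq_intros simp: field_simps)
    then show ?thesis
      by (intro has_vector_derivative_mult_right has_vector_derivative_of_real)
  qed
  ultimately show ?thesis by (rule vector_derivative_unique_at)
qed

text \<open>
  Pairing with the modulated Gaussians is the same as the Fourier transform of \<open>f\<close> times a fixed positive
  function, and this product is integrable even when \<open>f\<close> is only square integrable or bounded.
\<close>

lemma AE_zero_if_gauss_orthogonal:
  assumes int: "integrable lebesgue (\<lambda>x. f x * gauss 0 0 x)"
    and zero: "\<And>a. (LINT x|lebesgue. f x * gauss a 0 x) = 0"
  shows "AE x in lebesgue. f x = 0"
proof -
  have eq: "iexp (t * x) * (f x * gauss 0 0 x) = f x * gauss t 0 x" for t x
    by (simp add: gauss_def mult_ac)
  have "AE x in lebesgue. f x * gauss 0 0 x = 0"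
    by (rule AE_zero_if_transform_zero[OF int]) (simp only: eq zero)
  then show ?thesis by eventually_elim (simp add: gauss_def)
qed

section \<open>Uniqueness, inversion and Plancherel\<close>

lemma L2_gauss_integrable: "f \<in> L2 \<Longrightarrow> integrable lebesgue (\<lambda>x. f x * gauss a b x)"
  using integrable_mult_L2 gauss_L2 by blast

lemma fourier_transform_gauss_pairing:
  assumes "has_fourier_transform f g"
  shows "of_real (sqrt (2 * pi)) * iexp (a * b) * (LINT x|lebesgue. f x * gauss (- b) a x)
    = (LINT \<xi>|lebesgue. g \<xi> * gauss a b \<xi>)"
proof -
  have f: "f \<in> L2" using assms by (simp add: has_fourier_transform_def)
  have eq: "f x * fourier_integral (gauss a b) x
      = of_real (sqrt (2 * pi)) * iexp (a * b) * (f x * gauss (- b) a x)" for x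
    by (simp only: fourier_integral_gauss mult_ac)
  have "(LINT x|lebesgue. f x * fourier_integral (gauss a b) x) = (LINT \<xi>|lebesgue. g \<xi> * gauss a b \<xi>)"
    by (rule fourier_transform_duality[OF assms gauss_integrable gauss_L2])
       (simp only: eq, intro integrable_mult_right impI L2_gauss_integrable f)
  then show ?thesis by (simp only: eq integral_mult_right_zero)
qed

lemma fourier_transform_unique:
  assumes "has_fourier_transform f g1" "has_fourier_transform f g2"
  shows "AE \<xi> in lebesgue. g1 \<xi> = g2 \<xi>"
proof -
  have g: "g1 \<in> L2" "g2 \<in> L2" using assms by (auto simp: has_fourier_transform_def)
  have "AE \<xi> in lebesgue. g1 \<xi> - g2 \<xi> = 0"
  proof (rule AE_zero_if_gauss_orthogonal)
    show "integrable lebesgue (\<lambda>\<xi>. (g1 \<xi> - g2 \<xi>) * gauss 0 0 \<xi>)"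
      unfolding left_diff_distrib by (intro Bochner_Integration.integrable_diff L2_gauss_integrable g)
    show "(LINT \<xi>|lebesgue. (g1 \<xi> - g2 \<xi>) * gauss a 0 \<xi>) = 0" for a
      unfolding left_diff_distrib
      by (subst Bochner_Integration.integral_diff[OF L2_gauss_integrable[OF g(1)] L2_gauss_integrable[OF g(2)]])
         (simp only: fourier_transform_gauss_pairing[OF assms(1), symmetric]
           fourier_transform_gauss_pairing[OF assms(2), symmetric] diff_self)
  qed
  then show ?thesis by simp
qed

lemma fourier_transform_injective:
  assumes FT: "has_fourier_transform f1 g1" "has_fourier_transform f2 g2"
    and ae: "AE \<xi> in lebesgue. g1 \<xi> = g2 \<xi>"
  shows "AE x in lebesgue. f1 x = f2 x"
proof -
  have f: "f1 \<in> L2" "f2 \<in> L2" and g: "g1 \<in> L2" "g2 \<in> L2"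
    using FT by (auto simp: has_fourier_transform_def)
  have "AE x in lebesgue. f1 x - f2 x = 0"
  proof (rule AE_zero_if_gauss_orthogonal)
    show "integrable lebesgue (\<lambda>x. (f1 x - f2 x) * gauss 0 0 x)"
      unfolding left_diff_distrib by (intro Bochner_Integration.integrable_diff L2_gauss_integrable f)
    fix a
    have "(LINT \<xi>|lebesgue. g1 \<xi> * gauss 0 (- a) \<xi>) = (LINT \<xi>|lebesgue. g2 \<xi> * gauss 0 (- a) \<xi>)"
    proof (rule integral_cong_AE)
      show "AE \<xi> in lebesgue. g1 \<xi> * gauss 0 (- a) \<xi> = g2 \<xi> * gauss 0 (- a) \<xi>"
        using ae by eventually_elim simp
    qed (rule borel_measurable_integrable[OF L2_gauss_integrable], rule g)+
    then have "of_real (sqrt (2 * pi)) * (LINT x|lebesgue. f1 x * gauss a 0 x)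
        = of_real (sqrt (2 * pi)) * (LINT x|lebesgue. f2 x * gauss a 0 x)"
      using fourier_transform_gauss_pairing[OF FT(1), of 0 "- a"] fourier_transform_gauss_pairing[OF FT(2), of 0 "- a"]
      by simp
    then have "(LINT x|lebesgue. f1 x * gauss a 0 x) = (LINT x|lebesgue. f2 x * gauss a 0 x)"
      unfolding mult_cancel_left by simp
    then show "(LINT x|lebesgue. (f1 x - f2 x) * gauss a 0 x) = 0"
      unfolding left_diff_distrib
      by (subst Bochner_Integration.integral_diff[OF L2_gauss_integrable[OF f(1)] L2_gauss_integrable[OF f(2)]]) simp
  qed
  then show ?thesis by simp
qed

text \<open>
  On \<open>L\<^sup>1 \<inter> L\<^sup>2\<close> both transforms have the same pairings with the modulated Gaussians, one by duality and the
  other by the multiplication formula.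
\<close>

lemma fourier_transform_eq_fourier_integral:
  assumes FT: "has_fourier_transform f g" and f: "integrable lebesgue f"
  shows "AE \<xi> in lebesgue. g \<xi> = fourier_integral f \<xi>"
proof -
  have g: "g \<in> L2" and fL2: "f \<in> L2" using FT by (auto simp: has_fourier_transform_def)
  have i: "integrable lebesgue (\<lambda>\<xi>. fourier_integral f \<xi> * gauss a 0 \<xi>)" for a
    using integrable_bounded_mult[OF gauss_integrable fourier_integral_measurable[OF f] fourier_integral_bounded[OF f]] .
  have "AE \<xi> in lebesgue. g \<xi> - fourier_integral f \<xi> = 0"
  proof (rule AE_zero_if_gauss_orthogonal)
    show "integrable lebesgue (\<lambda>\<xi>. (g \<xi> - fourier_integral f \<xi>) * gauss 0 0 \<xi>)"
      unfolding left_diff_distrib by (intro Bochner_Integration.integrable_diff L2_gauss_integrable g i)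
    fix a
    have "(LINT \<xi>|lebesgue. g \<xi> * gauss a 0 \<xi>) = (LINT x|lebesgue. f x * fourier_integral (gauss a 0) x)"
      unfolding fourier_transform_gauss_pairing[OF FT, symmetric] fourier_integral_gauss
      by (subst integral_mult_right_zero[symmetric]) (simp only: mult_ac)
    also have "\<dots> = (LINT \<xi>|lebesgue. fourier_integral f \<xi> * gauss a 0 \<xi>)"
      by (rule fourier_integral_multiplication[OF f gauss_integrable])
    finally show "(LINT \<xi>|lebesgue. (g \<xi> - fourier_integral f \<xi>) * gauss a 0 \<xi>) = 0"
      unfolding left_diff_distrib
      by (subst Bochner_Integration.integral_diff[OF L2_gauss_integrable[OF g] i]) simp
  qed
  then show ?thesis by simp
qed

text \<open>
  Both sides have the same pairings with the modulated Gaussians: the left side by the multiplication formula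
  after a reflection of the variable, the right side by duality. Each of the two
  steps transforms one Gaussian and contributes a factor \<open>sqrt (2 pi)\<close>, which accounts for the constant.
\<close>

lemma fourier_inversion:
  assumes FT: "has_fourier_transform f g" and g: "integrable lebesgue g"
  shows "AE x in lebesgue. fourier_integral g (- x) = of_real (2 * pi) * f x"
proof -
  have f: "f \<in> L2" using FT by (auto simp: has_fourier_transform_def)
  have Fm[measurable]: "fourier_integral g \<in> borel_measurable borel"
    by (rule fourier_integral_measurable[OF g])
  have [measurable]: "gauss a b \<in> borel_measurable borel" for a b by (rule gauss_measurable)
  have i: "integrable lebesgue (\<lambda>x. fourier_integral g (- x) * gauss a 0 x)" for a
    by (rule integrable_bounded_mult[OF gauss_integrable _ fourier_integral_bounded[OF g]]) measurable
  have i2: "integrable lebesgue (\<lambda>x. of_real (2 * pi) * f x * gauss a 0 x)" for a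
    unfolding mult.assoc by (intro integrable_mult_right impI L2_gauss_integrable f)
  have "AE x in lebesgue. fourier_integral g (- x) - of_real (2 * pi) * f x = 0"
  proof (rule AE_zero_if_gauss_orthogonal)
    show "integrable lebesgue (\<lambda>x. (fourier_integral g (- x) - of_real (2 * pi) * f x) * gauss 0 0 x)"
      unfolding left_diff_distrib by (intro Bochner_Integration.integrable_diff i i2)
    fix a
    have s: "complex_of_real (sqrt (2 * pi)) * of_real (sqrt (2 * pi)) = of_real (2 * pi)"
      unfolding of_real_mult[symmetric] by simp
    have "(LINT x|lebesgue. fourier_integral g (- x) * gauss a 0 x)
        = (LINT x|lborel. fourier_integral g (- x) * gauss a 0 x)"
      by (subst integral_completion) auto
    also have "\<dots> = (LINT x|lborel. fourier_integral g x * gauss (- a) 0 x)"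
      by (subst lborel_integral_real_affine[where c = "-1" and t = 0]) (auto simp: gauss_def)
    also have "\<dots> = (LINT x|lebesgue. fourier_integral g x * gauss (- a) 0 x)"
      by (subst integral_completion) auto
    also have "\<dots> = (LINT \<xi>|lebesgue. g \<xi> * fourier_integral (gauss (- a) 0) \<xi>)"
      by (rule fourier_integral_multiplication[OF g gauss_integrable, symmetric])
    also have "\<dots> = of_real (sqrt (2 * pi)) * (LINT \<xi>|lebesgue. g \<xi> * gauss 0 (- a) \<xi>)"
      by (subst integral_mult_right_zero[symmetric]) (simp add: fourier_integral_gauss mult_ac)
    also have "\<dots> = of_real (sqrt (2 * pi)) * (of_real (sqrt (2 * pi)) * (LINT x|lebesgue. f x * gauss a 0 x))"
      using fourier_transform_gauss_pairing[OF FT, of 0 "- a"] by simp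
    also have "\<dots> = (LINT x|lebesgue. of_real (2 * pi) * f x * gauss a 0 x)"
      unfolding mult.assoc[symmetric] s
      by (subst integral_mult_right_zero[symmetric]) (simp add: mult.assoc)
    finally show "(LINT x|lebesgue. (fourier_integral g (- x) - of_real (2 * pi) * f x) * gauss a 0 x) = 0"
      unfolding left_diff_distrib
      by (subst Bochner_Integration.integral_diff[OF i i2]) simp
  qed
  then show ?thesis by simp
qed

lemma fourier_integral_cnj:
  "fourier_integral (\<lambda>\<xi>. cnj (g \<xi>)) x = cnj (fourier_integral g (- x))"
proof -
  have "fourier_integral (\<lambda>\<xi>. cnj (g \<xi>)) x = (LINT \<xi>|lebesgue. cnj (iexp (- (- x) * \<xi>) * g \<xi>))"
    unfolding fourier_integral_iexp by (simp add: exp_cnj)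
  also have "\<dots> = cnj (fourier_integral g (- x))"
    unfolding fourier_integral_iexp by (rule Bochner_Integration.integral_cnj)
  finally show ?thesis .
qed

lemma cnj_L2: "g \<in> L2 \<Longrightarrow> (\<lambda>x. cnj (g x)) \<in> L2"
  by (auto simp: L2_def intro!: measurable_compose[OF _ borel_measurable_continuous_onI[OF continuous_on_cnj[OF continuous_on_id]]])

text \<open>
  Apply duality with \<open>h = cnj g\<close>, whose Fourier integral is \<open>2 pi cnj f\<close> by inversion. Integrability of \<open>g\<close> makes
  \<open>h\<close> admissible.
\<close>

lemma fourier_plancherel:
  assumes FT: "has_fourier_transform f g" and g: "integrable lebesgue g"
  shows "(LINT \<xi>|lebesgue. (cmod (g \<xi>))\<^sup>2) = 2 * pi * (LINT x|lebesgue. (cmod (f x))\<^sup>2)"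
proof -
  have f: "f \<in> L2" and gL2: "g \<in> L2" using FT by (auto simp: has_fourier_transform_def)
  have [measurable]: "f \<in> borel_measurable lebesgue" using f by (rule L2_measurable)
  have gc: "integrable lebesgue (\<lambda>\<xi>. cnj (g \<xi>))" using g by simp
  have [measurable]: "fourier_integral (\<lambda>\<xi>. cnj (g \<xi>)) \<in> borel_measurable lebesgue"
    by (rule borel_imp_lebesgue_measurable[OF fourier_integral_measurable[OF gc]])
  have ae: "AE x in lebesgue. f x * fourier_integral (\<lambda>\<xi>. cnj (g \<xi>)) x = of_real (2 * pi * (cmod (f x))\<^sup>2)"
    using fourier_inversion[OF FT g]
    by eventually_elim
       (simp only: fourier_integral_cnj complex_cnj_mult complex_cnj_complex_of_real
         mult.left_commute[of "f _" "of_real (2 * pi)"] complex_norm_square[symmetric] of_real_mult[symmetric])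
  have i: "integrable lebesgue (\<lambda>x. 2 * pi * (cmod (f x))\<^sup>2)"
    using f unfolding L2_def by (intro integrable_mult_right impI) blast
  then have i': "integrable lebesgue (\<lambda>x. complex_of_real (2 * pi * (cmod (f x))\<^sup>2))"
    by (rule integrable_of_real)
  have "of_real (LINT x|lebesgue. 2 * pi * (cmod (f x))\<^sup>2) = (LINT x|lebesgue. complex_of_real (2 * pi * (cmod (f x))\<^sup>2))"
    by (rule integral_complex_of_real[symmetric])
  also have "\<dots> = (LINT x|lebesgue. f x * fourier_integral (\<lambda>\<xi>. cnj (g \<xi>)) x)"
    by (rule integral_cong_AE) (use ae in auto)
  also have "\<dots> = (LINT \<xi>|lebesgue. g \<xi> * cnj (g \<xi>))"
  proof (rule fourier_transform_duality[OF FT gc cnj_L2[OF gL2]])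
    show "integrable lebesgue (\<lambda>x. f x * fourier_integral (\<lambda>\<xi>. cnj (g \<xi>)) x)"
      using i' ae by (subst integrable_cong_AE) auto
  qed
  also have "\<dots> = (LINT \<xi>|lebesgue. of_real ((cmod (g \<xi>))\<^sup>2))"
    by (simp only: complex_norm_square)
  also have "\<dots> = of_real (LINT \<xi>|lebesgue. (cmod (g \<xi>))\<^sup>2)"
    by (rule integral_complex_of_real)
  finally show ?thesis
    unfolding of_real_eq_iff by simp
qed

section \<open>Smooth cutoff functions\<close>

text \<open>
  The classical functions that vanish to infinite order at \<open>0\<close>. The factor \<open>poly p (1 / x)\<close> makes the family
  closed under differentiation.
\<close>

definition flat_exp :: "real poly \<Rightarrow> real \<Rightarrow> real" where
  "flat_exp p x = (if x > 0 then poly p (1 / x) * exp (- (1 / x)) else 0)"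

definition flat_exp_step :: "real poly \<Rightarrow> real poly" where
  "flat_exp_step p = [:0, 0, 1:] * (p - pderiv p)"

lemma poly_exp_decay: "((\<lambda>y::real. poly p y * exp (- y)) \<longlongrightarrow> 0) at_top"
proof -
  have "((\<lambda>y::real. \<Sum>i\<le>degree p. coeff p i * (y ^ i / exp y)) \<longlongrightarrow> (\<Sum>i\<le>degree p. coeff p i * 0)) at_top"
    by (intro tendsto_sum tendsto_mult tendsto_const tendsto_power_div_exp_0)
  then show ?thesis
    by (simp add: poly_altdef exp_minus sum_distrib_right divide_inverse mult.assoc)
qed

text \<open>
  At \<open>0\<close> the difference quotient is again a polynomial in \<open>1 / x\<close> times \<open>exp (- 1 / x)\<close>, which tends to \<open>0\<close>
  because exponential decay beats every polynomial.
\<close>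

lemma flat_exp_has_derivative:
  "(flat_exp p has_real_derivative flat_exp (flat_exp_step p) x) (at x)"
proof -
  consider "x > 0" | "x < 0" | "x = 0" by linarith
  then show ?thesis
  proof cases
    case 1
    have "((\<lambda>x. poly p (1 / x) * exp (- (1 / x))) has_real_derivative
        flat_exp (flat_exp_step p) x) (at x)"
      using 1 by (auto intro!: derivative_eq_intros DERIV_chain'[where g = "poly p"] poly_DERIV
            simp: flat_exp_def flat_exp_step_def power2_eq_square algebra_simps divide_inverse)
    then show ?thesis
      by (rule has_field_derivative_transform_within_open[where S = "{0<..}"])
         (use 1 in \<open>auto simp: flat_exp_def\<close>)
  next
    case 2
    have "((\<lambda>x. 0) has_real_derivative flat_exp (flat_exp_step p) x) (at x)"
      using 2 by (auto simp: flat_exp_def)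
    then show ?thesis
      by (rule has_field_derivative_transform_within_open[where S = "{..<0}"])
         (use 2 in \<open>auto simp: flat_exp_def\<close>)
  next
    case 3
    have r: "((\<lambda>y. flat_exp p y / y) \<longlongrightarrow> 0) (at_right 0)"
    proof -
      have "((\<lambda>y::real. poly ([:0, 1:] * p) (inverse y) * exp (- inverse y)) \<longlongrightarrow> 0) (at_right 0)"
        using filterlim_compose[OF poly_exp_decay filterlim_inverse_at_top_right] .
      then show ?thesis
        by (rule Lim_transform_eventually)
           (auto simp: eventually_at_filter flat_exp_def divide_inverse mult_ac)
    qed
    have l: "((\<lambda>y. flat_exp p y / y) \<longlongrightarrow> 0) (at_left 0)"
      by (rule tendsto_eventually) (auto simp: eventually_at_filter flat_exp_def)
    have "((\<lambda>y. flat_exp p y / y) \<longlongrightarrow> 0) (at 0)"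
      using filterlim_split_at[OF l r] .
    then show ?thesis
      using 3 by (simp add: has_field_derivative_iff flat_exp_def)
  qed
qed

lemma flat_exp_affine_has_derivative:
  "((\<lambda>x. flat_exp p (a + c * x)) has_real_derivative c * flat_exp (flat_exp_step p) (a + c * x)) (at x)"
proof -
  have "((\<lambda>x. a + c * x) has_real_derivative c) (at x)"
    by (auto intro!: derivative_eq_intros)
  from DERIV_chain'[OF this flat_exp_has_derivative] show ?thesis
    by (simp only: mult.commute[of _ c])
qed

text \<open>
  A class of functions that contains the test functions needed below and is visibly closed under
  differentiation. This gives differentiability of all orders without computing any higher derivative.
\<close>

inductive smooth :: "(real \<Rightarrow> real) \<Rightarrow> bool" where
  smooth_const: "smooth (\<lambda>x. c)"
| smooth_id: "smooth (\<lambda>x. x)"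
| smooth_flat: "smooth (\<lambda>x. flat_exp p (1 + c * x))"
| smooth_gauss: "smooth (\<lambda>x. exp (- (x - a)\<^sup>2 / 2))"
| smooth_add: "smooth f \<Longrightarrow> smooth g \<Longrightarrow> smooth (\<lambda>x. f x + g x)"
| smooth_mult: "smooth f \<Longrightarrow> smooth g \<Longrightarrow> smooth (\<lambda>x. f x * g x)"

lemma smooth_has_derivative:
  "smooth f \<Longrightarrow> \<exists>f'. smooth f' \<and> (\<forall>x. (f has_real_derivative f' x) (at x))"
proof (induction rule: smooth.induct)
  case (smooth_const c)
  show ?case by (intro exI[of _ "\<lambda>x. 0"] conjI smooth.intros allI) (auto intro!: derivative_eq_intros)
next
  case smooth_id
  show ?case by (intro exI[of _ "\<lambda>x. 1"] conjI smooth.intros allI) (auto intro!: derivative_eq_intros)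
next
  case (smooth_flat p c)
  show ?case
    by (intro exI[of _ "\<lambda>x. c * flat_exp (flat_exp_step p) (1 + c * x)"] conjI smooth.intros allI
        flat_exp_affine_has_derivative)
next
  case (smooth_gauss a)
  show ?case
    by (intro exI[of _ "\<lambda>x. (a + (-1) * x) * exp (- (x - a)\<^sup>2 / 2)"] conjI smooth.intros allI)
       (auto intro!: derivative_eq_intros simp: field_simps)
next
  case (smooth_add f g)
  then obtain f' g' where "smooth f'" "smooth g'"
    "\<And>x. (f has_real_derivative f' x) (at x)" "\<And>x. (g has_real_derivative g' x) (at x)" by blast
  then show ?case
    by (intro exI[of _ "\<lambda>x. f' x + g' x"] conjI smooth.intros allI DERIV_add)
next
  case (smooth_mult f g)
  then obtain f' g' where "smooth f'" "smooth g'"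
    "\<And>x. (f has_real_derivative f' x) (at x)" "\<And>x. (g has_real_derivative g' x) (at x)" by blast
  then show ?case using smooth_mult.hyps
    by (intro exI[of _ "\<lambda>x. f x * g' x + f' x * g x"] conjI smooth.intros allI DERIV_mult')
qed

lemma smooth_funpow_deriv: "smooth f \<Longrightarrow> smooth ((deriv ^^ n) f)"
proof (induction n)
  case (Suc n)
  then obtain f' where f': "smooth f'" "\<And>x. ((deriv ^^ n) f has_real_derivative f' x) (at x)"
    using smooth_has_derivative by blast
  then have "deriv ((deriv ^^ n) f) = f'" by (intro ext DERIV_imp_deriv)
  then show ?case using f' by simp
qed simp

lemma smooth_test_function:
  assumes "smooth f" "bounded {x. f x \<noteq> 0}"
  shows "test_function f"
  unfolding test_function_def
proof (intro conjI allI)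
  fix n x
  obtain f' where "\<And>x. ((deriv ^^ n) f has_real_derivative f' x) (at x)"
    using smooth_has_derivative[OF smooth_funpow_deriv[OF assms(1)]] by blast
  then show "(deriv ^^ n) f differentiable (at x)"
    using real_differentiable_def by blast
qed (use assms(2) in simp)

text \<open>
  The coefficients \<open>1\<close> and \<open>-1\<close> are written out so that rescalings of both factors have the shape
  \<open>flat_exp p (1 + c x)\<close> of the generators of \<open>smooth\<close>.
\<close>

definition cutoff :: "real \<Rightarrow> real" where
  "cutoff x = flat_exp 1 (1 + 1 * x) * flat_exp 1 (1 + (-1) * x)"

lemma cutoff_0: "cutoff 0 \<noteq> 0"
  by (simp add: cutoff_def flat_exp_def)

lemma cutoff_outside: "\<bar>x\<bar> \<ge> 1 \<Longrightarrow> cutoff x = 0"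
  by (auto simp: cutoff_def flat_exp_def)

lemma cutoff_scaled_smooth: "smooth (\<lambda>x. cutoff (c * x))"
  proof -
  have "smooth (\<lambda>x. flat_exp 1 (1 + (1 * c) * x) * flat_exp 1 (1 + (- 1 * c) * x))"
    by (intro smooth.intros)
  then show ?thesis by (simp only: cutoff_def mult.assoc)
qed

lemma isCont_vanishing_bounded:
  fixes f :: "real \<Rightarrow> real"
  assumes "\<And>x. isCont f x" "\<And>x. \<bar>x\<bar> \<ge> 1 \<Longrightarrow> f x = 0"
  obtains C where "\<And>x. \<bar>f x\<bar> \<le> C"
proof -
  have "compact (f ` {-1..1})"
    by (intro compact_continuous_image continuous_at_imp_continuous_on) (use assms in auto)
  then obtain C where C: "\<forall>y\<in>f ` {-1..1}. norm y \<le> C"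
    using compact_imp_bounded bounded_iff by metis
  have "\<bar>f x\<bar> \<le> max C 0" for x
  proof (cases "\<bar>x\<bar> \<ge> 1")
    case False
    then have "x \<in> {-1..1}" by auto
    then have "\<bar>f x\<bar> \<le> C" using C by force
    then show ?thesis by simp
  qed (use assms in auto)
  then show ?thesis using that by blast
qed

lemma cutoff_derivative:
  obtains cutoff' C where "\<And>x. (cutoff has_real_derivative cutoff' x) (at x)"
    "\<And>x. \<bar>cutoff x\<bar> \<le> C" "\<And>x. \<bar>cutoff' x\<bar> \<le> C" "\<And>x. isCont cutoff' x"
proof -
  define q where "q = flat_exp_step 1"
  define k where "k x = flat_exp 1 (1 + 1 * x) * ((-1) * flat_exp q (1 + (-1) * x)) + 1 * flat_exp q (1 + 1 * x) * flat_exp 1 (1 + (-1) * x)" for x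
  have d: "(cutoff has_real_derivative k x) (at x)" for x
    unfolding cutoff_def[abs_def] k_def q_def
    by (intro DERIV_mult' flat_exp_affine_has_derivative)
  have kc: "isCont k x" for x
    unfolding k_def[abs_def]
    by (intro isCont_add isCont_mult continuous_const DERIV_isCont[OF flat_exp_affine_has_derivative])
  have k0: "k x = 0" if "\<bar>x\<bar> \<ge> 1" for x
    using that by (auto simp: k_def flat_exp_def)
  obtain C1 where C1: "\<And>x. \<bar>cutoff x\<bar> \<le> C1"
    using isCont_vanishing_bounded[of cutoff, OF DERIV_isCont[OF d] cutoff_outside] by blast
  obtain C2 where C2: "\<And>x. \<bar>k x\<bar> \<le> C2"
    using isCont_vanishing_bounded[of k, OF kc k0] by blast
  show ?thesis
    by (rule that[of k "max C1 C2", OF d _ _ kc]) (use C1 C2 in \<open>auto simp: le_max_iff_disj\<close>)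
qed

section \<open>Weak derivatives on the Fourier side\<close>

text \<open>
  Gaussians are not compactly supported. Multiply by the cutoffs \<open>cutoff (x / n)\<close>: in the weak identity the
  derivative of the cutoff carries a factor \<open>1 / n\<close>, and dominated convergence removes the cutoffs up to the
  common factor \<open>cutoff 0 \<noteq> 0\<close>.
\<close>

lemma weak_derivative_gaussian:
  assumes \<phi>: "\<phi> \<in> L2" and \<phi>': "\<phi>' \<in> L2" and weak: "weak_derivative \<phi> \<phi>'"
  shows "(LINT x|lebesgue. \<phi> x * of_real (- (x - a) * exp (- (x - a)\<^sup>2 / 2)))
    = - (LINT x|lebesgue. \<phi>' x * of_real (exp (- (x - a)\<^sup>2 / 2)))"
proof -
  define E where "E x = exp (- (x - a)\<^sup>2 / 2)" for x
  define E' where "E' x = - (x - a) * E x" for x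
  have E: "(E has_real_derivative E' x) (at x)" for x
    unfolding E_def[abs_def] E'_def by (auto intro!: derivative_eq_intros simp: field_simps)
  obtain k C where k: "\<And>x. (cutoff has_real_derivative k x) (at x)"
    "\<And>x. \<bar>cutoff x\<bar> \<le> C" "\<And>x. \<bar>k x\<bar> \<le> C" "\<And>x. isCont k x"
    using cutoff_derivative by blast
  have C: "C \<ge> 0" using k(2)[of 0] by linarith
  define c where "c n = inverse (real (Suc n))" for n
  have c: "c n > 0" "c n \<le> 1" for n by (auto simp: c_def field_simps)
  have c0: "c \<longlonglongrightarrow> 0" unfolding c_def[abs_def] by (rule LIMSEQ_inverse_real_of_nat)
  define \<eta> where "\<eta> n x = cutoff (c n * x) * E x" for n x
  have d\<eta>: "deriv (\<eta> n) x = cutoff (c n * x) * E' x + c n * k (c n * x) * E x" for n x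
  proof -
    have "((\<lambda>x. c n * x) has_real_derivative c n) (at x)"
      by (auto intro!: derivative_eq_intros)
    from DERIV_mult'[OF DERIV_chain'[OF this k(1)] E]
    show ?thesis unfolding \<eta>_def by (intro DERIV_imp_deriv) (simp add: mult.commute[of "k _"])
  qed
  have test: "test_function (\<eta> n)" for n
  proof (rule smooth_test_function)
    show "smooth (\<eta> n)"
      unfolding \<eta>_def[abs_def] E_def by (intro smooth_mult cutoff_scaled_smooth smooth_gauss)
    have "{x. \<eta> n x \<noteq> 0} \<subseteq> {- real (Suc n)..real (Suc n)}"
    proof
      fix x assume "x \<in> {x. \<eta> n x \<noteq> 0}"
      then have "\<bar>c n * x\<bar> < 1" using cutoff_outside[of "c n * x"] by (force simp: \<eta>_def)
      then show "x \<in> {- real (Suc n)..real (Suc n)}"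
        by (auto simp: c_def abs_mult field_simps abs_less_iff)
    qed
    then show "bounded {x. \<eta> n x \<noteq> 0}" using bounded_closed_interval bounded_subset by blast
  qed
  have weak_n: "(LINT x|lebesgue. \<phi> x * of_real (deriv (\<eta> n) x)) = - (LINT x|lebesgue. \<phi>' x * of_real (\<eta> n x))" for n
    using weak test by (simp add: weak_derivative_def)
  \<comment> \<open>\<open>E\<close> and \<open>E'\<close> are square integrable, so their products with \<open>\<phi>\<close> and \<open>\<phi>'\<close> dominate the integrands.\<close>
  have L2E: "(\<lambda>x. complex_of_real (E x)) \<in> L2"
    using gauss_L2[of 0 a] by (simp add: gauss_def[abs_def] E_def del: of_real_power of_real_diff)
  have L2E': "(\<lambda>x. complex_of_real (E' x)) \<in> L2"
  proof -
    have "(\<lambda>x. - (of_real ((x - a) ^ 1) * gauss 0 a x)) \<in> L2"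
      using gauss_moment_L2[of a 1 0]
      by (simp only: L2_def mem_Collect_eq norm_minus_cancel borel_measurable_uminus_eq)
    moreover have "(\<lambda>x. - (of_real ((x - a) ^ 1) * gauss 0 a x)) = (\<lambda>x. complex_of_real (E' x))"
      by (rule ext) (simp add: gauss_def E'_def E_def algebra_simps)
    ultimately show ?thesis by simp
  qed
  have [measurable]: "\<phi> \<in> borel_measurable lebesgue" "\<phi>' \<in> borel_measurable lebesgue"
    using \<phi> \<phi>' by (auto dest: L2_measurable)
  have Em[measurable]: "E \<in> borel_measurable borel" "E' \<in> borel_measurable borel"
    unfolding E'_def[abs_def] E_def[abs_def] by measurable
  have cut_m[measurable]: "cutoff \<in> borel_measurable borel" "k \<in> borel_measurable borel"
    by (auto intro!: borel_measurable_continuous_onI continuous_at_imp_continuous_on k(4) DERIV_isCont[OF k(1)])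
  have cutlim: "(\<lambda>n. cutoff (c n * x)) \<longlonglongrightarrow> cutoff 0" for x
    using isCont_tendsto_compose[OF DERIV_isCont[OF k(1), of 0], of "\<lambda>n. c n * x"] tendsto_mult_left_zero[OF c0] by blast
  have left: "(\<lambda>n. LINT x|lebesgue. \<phi> x * of_real (deriv (\<eta> n) x)) \<longlonglongrightarrow> (LINT x|lebesgue. \<phi> x * of_real (cutoff 0 * E' x))"
  proof (rule integral_dominated_convergence)
    show "integrable lebesgue (\<lambda>x. C * (cmod (\<phi> x * of_real (E' x)) + cmod (\<phi> x * of_real (E x))))"
      using integrable_mult_L2[OF \<phi> L2E] integrable_mult_L2[OF \<phi> L2E'] by auto
    have [measurable]: "(\<lambda>x. complex_of_real (deriv (\<eta> n) x)) \<in> borel_measurable lebesgue" for n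
      unfolding d\<eta> by (rule borel_imp_lebesgue_measurable) measurable
    show "(\<lambda>x. \<phi> x * of_real (deriv (\<eta> n) x)) \<in> borel_measurable lebesgue" for n
      by measurable
    have [measurable]: "(\<lambda>x. complex_of_real (cutoff 0 * E' x)) \<in> borel_measurable lebesgue"
      by (rule borel_imp_lebesgue_measurable) measurable
    show "(\<lambda>x. \<phi> x * of_real (cutoff 0 * E' x)) \<in> borel_measurable lebesgue"
      by measurable
    show "AE x in lebesgue. (\<lambda>n. \<phi> x * of_real (deriv (\<eta> n) x)) \<longlonglongrightarrow> \<phi> x * of_real (cutoff 0 * E' x)"
    proof (rule AE_I2)
      fix x
      have "(\<lambda>n. k (c n * x)) \<longlonglongrightarrow> k 0"
        using isCont_tendsto_compose[OF k(4)[of 0], of "\<lambda>n. c n * x"] tendsto_mult_left_zero[OF c0] by blast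
      then have "(\<lambda>n. cutoff (c n * x) * E' x + c n * k (c n * x) * E x) \<longlonglongrightarrow> cutoff 0 * E' x + 0 * k 0 * E x"
        by (intro tendsto_intros cutlim c0)
      then show "(\<lambda>n. \<phi> x * of_real (deriv (\<eta> n) x)) \<longlonglongrightarrow> \<phi> x * of_real (cutoff 0 * E' x)"
        unfolding d\<eta> by (intro tendsto_mult tendsto_const tendsto_of_real) simp
    qed
    show "AE x in lebesgue. cmod (\<phi> x * of_real (deriv (\<eta> n) x)) \<le> C * (cmod (\<phi> x * of_real (E' x)) + cmod (\<phi> x * of_real (E x)))" for n
    proof (rule AE_I2)
      fix x
      have E0: "E x \<ge> 0" by (simp add: E_def)
      have "\<bar>cutoff (c n * x) * E' x\<bar> \<le> C * \<bar>E' x\<bar>"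
        using k(2) by (simp add: abs_mult mult_right_mono)
      moreover have "\<bar>c n * k (c n * x) * E x\<bar> \<le> C * E x"
      proof -
        have "\<bar>c n * k (c n * x)\<bar> \<le> 1 * C"
          unfolding abs_mult by (intro mult_mono k(3)) (use c[of n] in auto)
        then show ?thesis using E0 by (simp add: abs_mult mult_right_mono)
      qed
      ultimately have "\<bar>deriv (\<eta> n) x\<bar> \<le> C * (\<bar>E' x\<bar> + E x)"
        unfolding d\<eta> distrib_left by linarith
      from mult_left_mono[OF this norm_ge_zero[of "\<phi> x"]]
      show "cmod (\<phi> x * of_real (deriv (\<eta> n) x)) \<le> C * (cmod (\<phi> x * of_real (E' x)) + cmod (\<phi> x * of_real (E x)))"
        using E0 by (simp add: norm_mult algebra_simps)
    qed
  qed
  have right: "(\<lambda>n. LINT x|lebesgue. \<phi>' x * of_real (\<eta> n x)) \<longlonglongrightarrow> (LINT x|lebesgue. \<phi>' x * of_real (cutoff 0 * E x))"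
  proof (rule integral_dominated_convergence)
    show "integrable lebesgue (\<lambda>x. C * cmod (\<phi>' x * of_real (E x)))"
      using integrable_mult_L2[OF \<phi>' L2E] by auto
    have [measurable]: "(\<lambda>x. complex_of_real (\<eta> n x)) \<in> borel_measurable lebesgue" for n
      unfolding \<eta>_def by (rule borel_imp_lebesgue_measurable) measurable
    show "(\<lambda>x. \<phi>' x * of_real (\<eta> n x)) \<in> borel_measurable lebesgue" for n
      by measurable
    have [measurable]: "(\<lambda>x. complex_of_real (cutoff 0 * E x)) \<in> borel_measurable lebesgue"
      by (rule borel_imp_lebesgue_measurable) measurable
    show "(\<lambda>x. \<phi>' x * of_real (cutoff 0 * E x)) \<in> borel_measurable lebesgue"
      by measurable
    show "AE x in lebesgue. (\<lambda>n. \<phi>' x * of_real (\<eta> n x)) \<longlonglongrightarrow> \<phi>' x * of_real (cutoff 0 * E x)"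
      unfolding \<eta>_def by (intro AE_I2 tendsto_intros cutlim)
    show "AE x in lebesgue. cmod (\<phi>' x * of_real (\<eta> n x)) \<le> C * cmod (\<phi>' x * of_real (E x))" for n
      using mult_right_mono[OF k(2)[of "c n * x" for x], of "cmod (\<phi>' x * of_real (E x))" for x]
      by (intro AE_I2) (simp add: \<eta>_def norm_mult abs_mult mult_ac)
  qed
  have "(LINT x|lebesgue. \<phi> x * of_real (cutoff 0 * E' x)) = - (LINT x|lebesgue. \<phi>' x * of_real (cutoff 0 * E x))"
    using LIMSEQ_unique[OF left[unfolded weak_n] tendsto_minus[OF right]] .
  moreover have scale: "(LINT x|lebesgue. f x * complex_of_real (cutoff 0 * g x))
      = of_real (cutoff 0) * (LINT x|lebesgue. f x * of_real (g x))" for f g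
    by (subst integral_mult_right_zero[symmetric]) (simp add: mult_ac)
  ultimately have "complex_of_real (cutoff 0) * (LINT x|lebesgue. \<phi> x * of_real (E' x))
      = of_real (cutoff 0) * - (LINT x|lebesgue. \<phi>' x * of_real (E x))"
    by (simp only: scale mult_minus_right)
  then show ?thesis
    unfolding mult_cancel_left using cutoff_0 by (simp only: E'_def E_def of_real_eq_0_iff simp_thms)
qed

text \<open>
  The equation \<open>- i \<phi>' = l \<phi> + q\<close> on the Fourier side. It is tested with the translated Gaussians
  \<open>gauss 0 a\<close>, whose inverse transforms are multiples of \<open>gauss a 0\<close>; the derivative that the weak formulation moves
  onto the Gaussian becomes multiplication by \<open>- i \<xi>\<close>. Since the \<open>gauss a 0\<close> separate functions, the
  identity holds almost everywhere.
\<close>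

lemma fourier_transform_differential_equation:
  assumes \<phi>': "\<phi>' \<in> L2" and weak: "weak_derivative \<phi> \<phi>'"
    and FT\<phi>: "has_fourier_transform \<phi> g" and FTq: "has_fourier_transform q k"
    and eq: "AE x in lebesgue. \<phi>' x = \<i> * (of_real l * \<phi> x + q x)"
  shows "AE \<xi> in lebesgue. of_real (\<xi> - l) * g \<xi> = k \<xi>"
proof -
  have \<phi>: "\<phi> \<in> L2" and g: "g \<in> L2" and q: "q \<in> L2" and k: "k \<in> L2"
    using FT\<phi> FTq by (auto simp: has_fourier_transform_def)
  define s where "s = complex_of_real (sqrt (2 * pi))"
  have m1: "(\<lambda>\<xi>. of_real \<xi> * gauss a 0 \<xi>) \<in> L2" "integrable lebesgue (\<lambda>\<xi>. of_real \<xi> * gauss a 0 \<xi>)" for a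
    using gauss_moment_L2[of 0 1 a] gauss_moment_integrable[of 0 1 a] by simp_all
  have i1: "integrable lebesgue (\<lambda>\<xi>. g \<xi> * (of_real \<xi> * gauss a 0 \<xi>))" for a
    by (rule integrable_mult_L2[OF g m1(1)])
  note ig = L2_gauss_integrable[OF g, of _ 0] and ik = L2_gauss_integrable[OF k, of _ 0]
  have i2: "integrable lebesgue (\<lambda>\<xi>. of_real l * (g \<xi> * gauss a 0 \<xi>))" for a
    by (intro integrable_mult_right impI ig)
  have split: "(of_real (\<xi> - l) * g \<xi> - k \<xi>) * gauss a 0 \<xi>
      = g \<xi> * (of_real \<xi> * gauss a 0 \<xi>) - of_real l * (g \<xi> * gauss a 0 \<xi>) - k \<xi> * gauss a 0 \<xi>" for \<xi> a
    by (simp add: algebra_simps)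
  have "AE \<xi> in lebesgue. of_real (\<xi> - l) * g \<xi> - k \<xi> = 0"
  proof (rule AE_zero_if_gauss_orthogonal)
    show "integrable lebesgue (\<lambda>\<xi>. (of_real (\<xi> - l) * g \<xi> - k \<xi>) * gauss 0 0 \<xi>)"
      unfolding split by (intro Bochner_Integration.integrable_diff i1 i2 ik)
    fix a
    define h where "h \<xi> = - \<i> * (of_real \<xi> * gauss a 0 \<xi>)" for \<xi>
    have h: "h \<in> L2" "integrable lebesgue h"
      using m1[of a] by (auto simp: h_def[abs_def] L2_def norm_mult)
    have Fh: "fourier_integral h x = s * of_real (- (x - a) * exp (- (x - a)\<^sup>2 / 2))" for x
      unfolding h_def[abs_def] s_def by (rule fourier_integral_moment_gauss)
    have gauss0: "gauss 0 a x = of_real (exp (- (x - a)\<^sup>2 / 2))" for x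
      by (simp add: gauss_def)
    have E'g: "of_real (- (x - a) * exp (- (x - a)\<^sup>2 / 2)) = - (of_real ((x - a) ^ 1) * gauss 0 a x)" for x
      by (simp only: gauss0 power_one_right of_real_mult of_real_minus minus_mult_left)
    have int: "integrable lebesgue (\<lambda>x. \<phi> x * fourier_integral h x)"
      unfolding Fh E'g mult.left_commute[of _ s] mult_minus_right
      by (intro integrable_minus integrable_mult_right impI integrable_mult_L2[OF \<phi> gauss_moment_L2])
    have A: "s * (LINT x|lebesgue. \<phi> x * of_real (- (x - a) * exp (- (x - a)\<^sup>2 / 2))) = (LINT \<xi>|lebesgue. g \<xi> * h \<xi>)"
      unfolding fourier_transform_duality[OF FT\<phi> h(2) h(1) int, symmetric] Fh
      by (subst integral_mult_right_zero[symmetric]) (simp only: mult.left_commute)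
    have i\<phi>: "integrable lebesgue (\<lambda>x. of_real l * (\<phi> x * gauss 0 a x))"
      by (intro integrable_mult_right impI L2_gauss_integrable \<phi>)
    have iq: "integrable lebesgue (\<lambda>x. q x * gauss 0 a x)"
      by (rule L2_gauss_integrable[OF q])
    have [measurable]: "\<phi> \<in> borel_measurable lebesgue" "q \<in> borel_measurable lebesgue" "\<phi>' \<in> borel_measurable lebesgue"
      "gauss 0 a \<in> borel_measurable lebesgue"
      using \<phi> q \<phi>' gauss_L2 by (auto dest: L2_measurable)
    have "(LINT x|lebesgue. \<phi>' x * gauss 0 a x)
        = (LINT x|lebesgue. \<i> * (of_real l * (\<phi> x * gauss 0 a x) + q x * gauss 0 a x))"
    proof (rule integral_cong_AE)
      show "AE x in lebesgue. \<phi>' x * gauss 0 a x = \<i> * (of_real l * (\<phi> x * gauss 0 a x) + q x * gauss 0 a x)"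
        using eq by eventually_elim (simp add: algebra_simps)
    qed measurable
    also have "\<dots> = \<i> * (of_real l * (LINT x|lebesgue. \<phi> x * gauss 0 a x) + (LINT x|lebesgue. q x * gauss 0 a x))"
      by (simp only: integral_mult_right_zero Bochner_Integration.integral_add[OF i\<phi> iq])
    finally have "s * (LINT x|lebesgue. \<phi>' x * gauss 0 a x)
       = \<i> * (of_real l * (s * (LINT x|lebesgue. \<phi> x * gauss 0 a x)) + s * (LINT x|lebesgue. q x * gauss 0 a x))"
      by (simp add: algebra_simps)
    also have "s * (LINT x|lebesgue. \<phi> x * gauss 0 a x) = (LINT \<xi>|lebesgue. g \<xi> * gauss a 0 \<xi>)"
      using fourier_transform_gauss_pairing[OF FT\<phi>, of a 0] by (simp add: s_def)
    also have "s * (LINT x|lebesgue. q x * gauss 0 a x) = (LINT \<xi>|lebesgue. k \<xi> * gauss a 0 \<xi>)"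
      using fourier_transform_gauss_pairing[OF FTq, of a 0] by (simp add: s_def)
    finally have B: "s * (LINT x|lebesgue. \<phi>' x * gauss 0 a x)
       = \<i> * (of_real l * (LINT \<xi>|lebesgue. g \<xi> * gauss a 0 \<xi>) + (LINT \<xi>|lebesgue. k \<xi> * gauss a 0 \<xi>))" .
    have "(LINT \<xi>|lebesgue. g \<xi> * h \<xi>) = - \<i> * (LINT \<xi>|lebesgue. g \<xi> * (of_real \<xi> * gauss a 0 \<xi>))"
      unfolding h_def by (subst integral_mult_right_zero[symmetric]) (simp only: mult.left_commute)
    with A weak_derivative_gaussian[OF \<phi> \<phi>' weak, of a, folded gauss0] B
    have "- \<i> * (LINT \<xi>|lebesgue. g \<xi> * (of_real \<xi> * gauss a 0 \<xi>))
      = - (\<i> * (of_real l * (LINT \<xi>|lebesgue. g \<xi> * gauss a 0 \<xi>) + (LINT \<xi>|lebesgue. k \<xi> * gauss a 0 \<xi>)))"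
      by simp
    then have C: "(LINT \<xi>|lebesgue. g \<xi> * (of_real \<xi> * gauss a 0 \<xi>))
      = of_real l * (LINT \<xi>|lebesgue. g \<xi> * gauss a 0 \<xi>) + (LINT \<xi>|lebesgue. k \<xi> * gauss a 0 \<xi>)"
      by simp
    show "(LINT \<xi>|lebesgue. (of_real (\<xi> - l) * g \<xi> - k \<xi>) * gauss a 0 \<xi>) = 0"
      unfolding split
      by (subst Bochner_Integration.integral_diff[OF Bochner_Integration.integrable_diff[OF i1 i2] ik],
          subst Bochner_Integration.integral_diff[OF i1 i2])
         (simp only: C integral_mult_right_zero add_diff_cancel_left' diff_self)
  qed
  then show ?thesis by simp
qed

section \<open>The boundary identity on the half-line\<close>

text \<open>
  On the half-line \<open>(\<xi> - l)\<^sup>2 \<ge> \<xi>\<^sup>2 + l\<^sup>2\<close> because \<open>l < 0\<close>. Dividing by the symbol \<open>\<xi> - l\<close> therefore turns \<open>L\<^sup>2\<close> functions supported there into integrable ones.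
\<close>

lemma resolvent_L2:
  assumes l: "l < 0"
  shows "(\<lambda>\<xi>. indicator {0..} \<xi> / complex_of_real (\<xi> - l)) \<in> L2"
proof -
  have "(\<lambda>\<xi>. indicator {0..} \<xi> / complex_of_real (\<xi> - l)) \<in> borel_measurable lebesgue"
    by (rule borel_imp_lebesgue_measurable) measurable
  moreover have "integrable lborel (\<lambda>\<xi>. (cmod (indicator {0..} \<xi> / complex_of_real (\<xi> - l)))\<^sup>2)"
  proof (rule Bochner_Integration.integrable_bound)
    show "integrable lborel (\<lambda>\<xi>. (1 + 1 / l\<^sup>2) * inverse (1 + \<xi>\<^sup>2))"
      using integrable_inverse_1_plus_square by (simp add: set_integrable_def)
    have "(cmod (indicator {0..} \<xi> / complex_of_real (\<xi> - l)))\<^sup>2 \<le> (1 + 1 / l\<^sup>2) * inverse (1 + \<xi>\<^sup>2)" for \<xi>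
    proof (cases "\<xi> \<ge> 0")
      case True
      have a: "\<xi>\<^sup>2 + l\<^sup>2 \<le> (\<xi> - l)\<^sup>2"
        using True l mult_nonneg_nonpos[of \<xi> l] by (simp add: power2_diff)
      have "1 + \<xi>\<^sup>2 \<le> (1 + 1 / l\<^sup>2) * (\<xi>\<^sup>2 + l\<^sup>2)"
        using l by (simp add: field_simps)
      also have "\<dots> \<le> (1 + 1 / l\<^sup>2) * (\<xi> - l)\<^sup>2"
        using a by (intro mult_left_mono) auto
      finally have "1 / (\<xi> - l)\<^sup>2 \<le> (1 + 1 / l\<^sup>2) / (1 + \<xi>\<^sup>2)"
        using True l by (simp add: pos_divide_le_eq pos_le_divide_eq add_pos_nonneg)
      then show ?thesis
        using True by (simp add: norm_divide power_divide norm_inverse power_inverse divide_inverse del: of_real_diff)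
    qed (simp add: add_pos_nonneg)
    then show "AE \<xi> in lborel. norm ((cmod (indicator {0..} \<xi> / complex_of_real (\<xi> - l)))\<^sup>2)
        \<le> norm ((1 + 1 / l\<^sup>2) * inverse (1 + \<xi>\<^sup>2))"
      by (intro AE_I2) (smt (verit) real_norm_def zero_le_power2)
  qed measurable
  ultimately show ?thesis
    unfolding L2_def by (auto simp: integrable_completion)
qed

text \<open>
  Integrate the derivative of \<open>\<bar>F \<xi>\<bar>\<^sup>2 / (\<xi> - l) = (\<xi> - l) \<bar>G \<xi>\<bar>\<^sup>2\<close> over the half-line. This function tends to \<open>0\<close> at
  infinity because \<open>F\<close> is bounded, and the derivative is \<open>2 Re (F' cnj G) - \<bar>G\<bar>\<^sup>2\<close>.
\<close>

lemma half_line_boundary_identity: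
  fixes F F' :: "real \<Rightarrow> complex"
  assumes l: "l < 0"
    and F: "\<And>\<xi>. (F has_vector_derivative F' \<xi>) (at \<xi>)"
    and F': "\<And>\<xi>. isCont F' \<xi>"
    and bound: "\<And>\<xi>. cmod (F \<xi>) \<le> B"
    and G: "\<And>\<xi>. G \<xi> = indicator {0..} \<xi> * (F \<xi> / of_real (\<xi> - l))"
    and G2: "integrable lebesgue (\<lambda>\<xi>. (cmod (G \<xi>))\<^sup>2)"
    and F'G: "integrable lebesgue (\<lambda>\<xi>. F' \<xi> * cnj (G \<xi>))"
  shows "(cmod (F 0))\<^sup>2 / \<bar>l\<bar>
    = (LINT \<xi>|lebesgue. (cmod (G \<xi>))\<^sup>2) - 2 * Re (LINT \<xi>|lebesgue. F' \<xi> * cnj (G \<xi>))"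
proof -
  define h where "h \<xi> = (cmod (F \<xi>))\<^sup>2 / (\<xi> - l)" for \<xi>
  define f where "f \<xi> = 2 * Re (F' \<xi> * cnj (F \<xi> / of_real (\<xi> - l))) - (cmod (F \<xi> / of_real (\<xi> - l)))\<^sup>2" for \<xi>
  define f0 where "f0 \<xi> = 2 * Re (F' \<xi> * cnj (G \<xi>)) - (cmod (G \<xi>))\<^sup>2" for \<xi>
  have Fc: "isCont F \<xi>" for \<xi>
    using F has_vector_derivative_continuous by blast
  have [measurable]: "F \<in> borel_measurable borel" "F' \<in> borel_measurable borel"
    by (auto intro!: borel_measurable_continuous_onI continuous_at_imp_continuous_on Fc F')
  have f0m: "f0 \<in> borel_measurable borel"
  proof -
    have "G = (\<lambda>\<xi>. indicator {0..} \<xi> * (F \<xi> / of_real (\<xi> - l)))" by (rule ext) (rule G)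
    then have [measurable]: "G \<in> borel_measurable borel" by simp
    have [measurable]: "cnj \<in> borel_measurable borel"
      by (intro borel_measurable_continuous_onI continuous_intros)
    show ?thesis unfolding f0_def[abs_def] by measurable
  qed
  have f0i: "integrable lebesgue f0"
    unfolding f0_def[abs_def]
    by (intro Bochner_Integration.integrable_diff integrable_mult_right impI integrable_Re F'G G2)
  then have f0b: "integrable lborel f0"
    using f0m by (simp add: integrable_completion)
  \<comment> \<open>\<open>f\<close> is continuous on the open half-line, as the fundamental theorem requires; \<open>f0\<close> is defined on the whole
    line and carries the integrability.\<close>
  have ff0: "indicator {0<..} \<xi> *\<^sub>R f \<xi> = indicator {0<..} \<xi> *\<^sub>R f0 \<xi>" for \<xi>
    by (auto simp: indicator_def f_def f0_def G)
  have h: "(h has_vector_derivative f \<xi>) (at \<xi>)" if "\<xi> > 0" for \<xi>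
  proof -
    have nz: "\<xi> - l > 0" using that l by simp
    have R: "((\<lambda>x. Re (F x)) has_real_derivative Re (F' \<xi>)) (at \<xi>)"
      "((\<lambda>x. Im (F x)) has_real_derivative Im (F' \<xi>)) (at \<xi>)"
      unfolding has_real_derivative_iff_has_vector_derivative
      using bounded_linear.has_vector_derivative[OF bounded_linear_Re F]
        bounded_linear.has_vector_derivative[OF bounded_linear_Im F] by auto
    have quot: "((\<lambda>x. ((a x)\<^sup>2 + (b x)\<^sup>2) / (x - l)) has_real_derivative
       ((2 * a \<xi> * a' + 2 * b \<xi> * b') * (\<xi> - l) - ((a \<xi>)\<^sup>2 + (b \<xi>)\<^sup>2)) / (\<xi> - l)\<^sup>2) (at \<xi>)"
      if "(a has_real_derivative a') (at \<xi>)" "(b has_real_derivative b') (at \<xi>)" for a b a' b'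
      using nz that by (auto intro!: derivative_eq_intros simp: power2_eq_square)
    have "((\<lambda>x. ((Re (F x))\<^sup>2 + (Im (F x))\<^sup>2) / (x - l)) has_real_derivative
       ((2 * Re (F \<xi>) * Re (F' \<xi>) + 2 * Im (F \<xi>) * Im (F' \<xi>)) * (\<xi> - l)
         - ((Re (F \<xi>))\<^sup>2 + (Im (F \<xi>))\<^sup>2)) / (\<xi> - l)\<^sup>2) (at \<xi>)"
      by (rule quot[OF R])
    also have "((2 * Re (F \<xi>) * Re (F' \<xi>) + 2 * Im (F \<xi>) * Im (F' \<xi>)) * (\<xi> - l)
         - ((Re (F \<xi>))\<^sup>2 + (Im (F \<xi>))\<^sup>2)) / (\<xi> - l)\<^sup>2 = f \<xi>"
    proof -
      have 1: "cnj (F \<xi> / of_real (\<xi> - l)) = cnj (F \<xi>) / of_real (\<xi> - l)" by simp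
      have 2: "Re (F' \<xi> * cnj (F \<xi>) / of_real (\<xi> - l)) = Re (F' \<xi> * cnj (F \<xi>)) / (\<xi> - l)"
        by (rule Re_divide_of_real)
      have 3: "(cmod (F \<xi> / of_real (\<xi> - l)))\<^sup>2 = ((Re (F \<xi>))\<^sup>2 + (Im (F \<xi>))\<^sup>2) / (\<xi> - l)\<^sup>2"
        by (simp add: norm_divide power_divide cmod_power2 del: of_real_diff)
      have 4: "2 * Re (F \<xi>) * Re (F' \<xi>) + 2 * Im (F \<xi>) * Im (F' \<xi>) = 2 * Re (F' \<xi> * cnj (F \<xi>))"
        by (simp add: algebra_simps)
      have 5: "y * (\<xi> - l) / (\<xi> - l)\<^sup>2 = y / (\<xi> - l)" for y
        using nz by (simp add: power2_eq_square)
      show ?thesis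
        unfolding f_def 1 times_divide_eq_right 2 3 4 diff_divide_distrib 5 ..
    qed
    finally show ?thesis
      unfolding has_real_derivative_iff_has_vector_derivative h_def[abs_def] cmod_power2 .
  qed
  have fcont: "isCont f \<xi>" if "\<xi> > 0" for \<xi>
  proof -
    have c: "isCont (\<lambda>x. F x / complex_of_real (x - l)) \<xi>"
      using that l by (intro continuous_intros Fc) (simp del: of_real_diff)
    show ?thesis
      unfolding f_def[abs_def]
      by (intro continuous_diff continuous_mult continuous_const continuous_power continuous_norm
          isCont_Re isCont_cnj c F')
  qed
  have "(LBINT \<xi>=0..\<infinity>. f \<xi>) = 0 - (cmod (F 0))\<^sup>2 / \<bar>l\<bar>"
  proof (rule interval_integral_FTC_integrable[where F = h])
    show "(h has_vector_derivative f x) (at x)" if "0 < ereal x" for x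
      using h that by simp
    show "isCont f x" if "0 < ereal x" for x using fcont that by simp
    have "einterval 0 \<infinity> = {0<..}" by (simp add: zero_ereal_def)
    then show "set_integrable lborel (einterval 0 \<infinity>) f"
      unfolding set_integrable_def by (simp only: ff0) (rule integrable_mult_indicator, simp, rule f0b)
    have "isCont h 0"
      unfolding h_def[abs_def] using l by (intro continuous_intros Fc) auto
    then have "(h \<longlongrightarrow> (cmod (F 0))\<^sup>2 / \<bar>l\<bar>) (at_right 0)"
      using l by (auto simp: isCont_def h_def intro: filterlim_mono at_le dest: filterlim_at_withinI)
    then show "((h \<circ> real_of_ereal) \<longlongrightarrow> (cmod (F 0))\<^sup>2 / \<bar>l\<bar>) (at_right 0)"
      by (simp add: zero_ereal_def ereal_tendsto_simps)
    have "(h \<longlongrightarrow> 0) at_top"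
    proof (rule tendsto_sandwich[where f = "\<lambda>_. 0" and h = "\<lambda>\<xi>. B\<^sup>2 / (\<xi> - l)"])
      show "\<forall>\<^sub>F \<xi> in at_top. 0 \<le> h \<xi>"
        using eventually_gt_at_top[of 0] by eventually_elim (use l in \<open>auto simp: h_def\<close>)
      show "\<forall>\<^sub>F \<xi> in at_top. h \<xi> \<le> B\<^sup>2 / (\<xi> - l)"
        using eventually_gt_at_top[of 0]
        by eventually_elim (use l bound in \<open>auto simp: h_def intro!: divide_right_mono power_mono\<close>)
      show "((\<lambda>\<xi>. B\<^sup>2 / (\<xi> - l)) \<longlongrightarrow> 0) at_top"
      proof (rule tendsto_divide_0[OF tendsto_const], rule filterlim_at_top_imp_at_infinity)
        show "filterlim (\<lambda>\<xi>. \<xi> - l) at_top at_top"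
          using filterlim_tendsto_add_at_top[OF tendsto_const[of "- l"] filterlim_ident] by simp
      qed
    qed simp
    then show "((h \<circ> real_of_ereal) \<longlongrightarrow> 0) (at_left \<infinity>)"
      by (simp add: ereal_tendsto_simps)
  qed simp
  also have "(LBINT \<xi>=0..\<infinity>. f \<xi>) = (LINT \<xi>|lborel. indicator {0<..} \<xi> *\<^sub>R f0 \<xi>)"
    by (simp only: interval_lebesgue_integral_0_infty set_lebesgue_integral_def ff0)
  also have "\<dots> = (LINT \<xi>|lborel. f0 \<xi>)"
  proof (rule integral_cong_AE)
    show "AE \<xi> in lborel. indicator {0<..} \<xi> *\<^sub>R f0 \<xi> = f0 \<xi>"
      using AE_lborel_singleton[of 0]
      by eventually_elim (auto simp: indicator_def f0_def G)
  qed (use f0m in measurable)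
  also have "\<dots> = (LINT \<xi>|lebesgue. f0 \<xi>)"
    using f0m by (simp add: integral_completion)
  also have "\<dots> = 2 * Re (LINT \<xi>|lebesgue. F' \<xi> * cnj (G \<xi>)) - (LINT \<xi>|lebesgue. (cmod (G \<xi>))\<^sup>2)"
  proof -
    have "integrable lebesgue (\<lambda>\<xi>. 2 * Re (F' \<xi> * cnj (G \<xi>)))"
      by (intro integrable_mult_right impI integrable_Re F'G)
    from Bochner_Integration.integral_diff[OF this G2] show ?thesis
      by (simp only: f0_def integral_mult_right_zero Bochner_Integration.integral_Re[OF F'G])
  qed
  finally show ?thesis by simp
qed

section \<open>The eigenvector identity\<close>

theorem lemma2p5:
  fixes u :: "real \<Rightarrow> real" and l :: real and \<phi> :: "real \<Rightarrow> complex"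
  assumes "u \<in> L2 \<inter> Linfty"
    and "(\<lambda>x. x * u x) \<in> L2"
    and "l < 0"
    and "Lu_eigenvalue u (of_real l)"
    and "Lu_eigenvector u (of_real l) \<phi>"
  shows "(cmod (LINT x|lebesgue. of_real (u x) * \<phi> x))\<^sup>2
           = 2 * pi * \<bar>l\<bar> * (LINT x|lebesgue. (cmod (\<phi> x))\<^sup>2)"
proof -
  note l = assms(3)
  obtain \<phi>' p q where hardy: "\<phi> \<in> hardy_space" and \<phi>': "\<phi>' \<in> L2" and weak: "weak_derivative \<phi> \<phi>'"
    and Cp: "cauchy_projection \<phi> p" and Cq: "cauchy_projection (\<lambda>x. of_real (u x) * p x) q"
    and eigen: "AE x in lebesgue. of_real l * \<phi> x = (1 / \<i>) * \<phi>' x - q x"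
    using assms(5) unfolding Lu_eigenvector_def Lu_graph_def by blast
  define w where "w x = of_real (u x) * p x" for x
  obtain g where FT\<phi>: "has_fourier_transform \<phi> g" and FTp: "has_fourier_transform p (\<lambda>\<xi>. indicator {0..} \<xi> * g \<xi>)"
    using Cp unfolding cauchy_projection_def by blast
  obtain k where FTw: "has_fourier_transform w k" and FTq: "has_fourier_transform q (\<lambda>\<xi>. indicator {0..} \<xi> * k \<xi>)"
    using Cq unfolding cauchy_projection_def w_def[abs_def] by blast
  have \<phi>: "\<phi> \<in> L2" and p: "p \<in> L2" and g: "g \<in> L2" and k1: "(\<lambda>\<xi>. indicator {0..} \<xi> * k \<xi>) \<in> L2"
    using FT\<phi> FTp FTq by (auto simp: has_fourier_transform_def)
  \<comment> \<open>Membership in the Hardy space supplies a possibly different transform of \<open>\<phi>\<close>; uniqueness identifies it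
    with \<open>g\<close>.\<close>
  have g_neg: "AE \<xi> in lebesgue. \<xi> < 0 \<longrightarrow> g \<xi> = 0"
  proof -
    obtain g0 where "has_fourier_transform \<phi> g0" "AE \<xi> in lebesgue. \<xi> < 0 \<longrightarrow> g0 \<xi> = 0"
      using hardy unfolding hardy_space_def by blast
    then show ?thesis using fourier_transform_unique[OF FT\<phi>, of g0] by (auto elim: AE_mp)
  qed
  \<comment> \<open>The projection is the identity on the Hardy space.\<close>
  have p_eq: "AE x in lebesgue. p x = \<phi> x"
  proof (rule fourier_transform_injective[OF FTp FT\<phi>])
    show "AE \<xi> in lebesgue. indicator {0..} \<xi> * g \<xi> = g \<xi>"
      using g_neg by eventually_elim (auto simp: indicator_def)
  qed
  have uL2: "(\<lambda>x. complex_of_real (u x)) \<in> L2" and xuL2: "(\<lambda>x. complex_of_real (x * u x)) \<in> L2"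
    using assms(1,2)
    by (auto simp: L2_def simp del: of_real_mult intro!: measurable_compose[OF _ borel_measurable_of_real])
  have w: "integrable lebesgue w"
    unfolding w_def[abs_def] by (rule integrable_mult_L2[OF uL2 p])
  have xw: "integrable lebesgue (\<lambda>x. of_real x * w x)"
    using integrable_mult_L2[OF xuL2 p] by (simp add: w_def mult.assoc)
  define v where "v x = - \<i> * (of_real x * w x)" for x
  have v: "integrable lebesgue v" unfolding v_def[abs_def] by (intro integrable_mult_right impI xw)
  define F where "F = fourier_integral w"
  \<comment> \<open>The decay hypothesis on \<open>x u\<close> enters here: it makes \<open>F\<close> continuously differentiable.\<close>
  have dF: "(F has_vector_derivative fourier_integral v \<xi>) (at \<xi>)" for \<xi>
    unfolding F_def v_def[abs_def] by (rule fourier_integral_has_derivative[OF w xw])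
  have k_eq: "AE \<xi> in lebesgue. k \<xi> = F \<xi>"
    unfolding F_def by (rule fourier_transform_eq_fourier_integral[OF FTw w])
  have ode: "AE \<xi> in lebesgue. of_real (\<xi> - l) * g \<xi> = indicator {0..} \<xi> * k \<xi>"
  proof (rule fourier_transform_differential_equation[OF \<phi>' weak FT\<phi> FTq])
    show "AE x in lebesgue. \<phi>' x = \<i> * (of_real l * \<phi> x + q x)"
      using eigen by eventually_elim simp
  qed
  define G where "G \<xi> = indicator {0..} \<xi> * (F \<xi> / of_real (\<xi> - l))" for \<xi>
  have nz: "complex_of_real (\<xi> - l) \<noteq> 0" if "\<xi> \<ge> 0" for \<xi>
    using that l by (simp del: of_real_diff)
  have g_res: "AE \<xi> in lebesgue. g \<xi> = indicator {0..} \<xi> / of_real (\<xi> - l) * (indicator {0..} \<xi> * k \<xi>)"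
    using ode g_neg
  proof eventually_elim
    case (elim \<xi>)
    show ?case
    proof (cases "\<xi> \<ge> 0")
      case True
      then show ?thesis using elim(1) nz[OF True] by (simp add: eq_divide_eq mult.commute del: of_real_diff)
    qed (use elim(2) in simp)
  qed
  have gG: "AE \<xi> in lebesgue. g \<xi> = G \<xi>"
    using g_res k_eq by eventually_elim (auto simp: G_def indicator_def)
  have [measurable]: "g \<in> borel_measurable lebesgue" "\<phi> \<in> borel_measurable lebesgue" "p \<in> borel_measurable lebesgue"
    "(\<lambda>x. complex_of_real (u x)) \<in> borel_measurable lebesgue"
    using g \<phi> p uL2 by (auto dest: L2_measurable)
  have g1: "integrable lebesgue g"
  proof -
    have i: "integrable lebesgue (\<lambda>\<xi>. indicator {0..} \<xi> / of_real (\<xi> - l) * (indicator {0..} \<xi> * k \<xi>))"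
      by (rule integrable_mult_L2[OF resolvent_L2[OF l] k1])
    show ?thesis
      by (subst integrable_cong_AE[OF _ _ g_res]) (use i in auto)
  qed
  have Fm: "F \<in> borel_measurable borel" unfolding F_def by (rule fourier_integral_measurable[OF w])
  have Gm[measurable]: "G \<in> borel_measurable lebesgue"
  proof (rule borel_imp_lebesgue_measurable)
    have [measurable]: "F \<in> borel_measurable borel" by (rule Fm)
    show "G \<in> borel_measurable borel" unfolding G_def[abs_def] by measurable
  qed
  have G1: "integrable lebesgue G"
    using g1 gG by (subst integrable_cong_AE[of _ _ g]) auto
  have gG2: "AE \<xi> in lebesgue. (cmod (g \<xi>))\<^sup>2 = (cmod (G \<xi>))\<^sup>2"
    using gG by eventually_elim simp
  have G2: "integrable lebesgue (\<lambda>\<xi>. (cmod (G \<xi>))\<^sup>2)"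
    by (subst integrable_cong_AE[of _ _ "\<lambda>\<xi>. (cmod (g \<xi>))\<^sup>2"]) (use g gG2 in \<open>auto simp: L2_def\<close>)
  have Gc: "integrable lebesgue (\<lambda>\<xi>. cnj (G \<xi>))" using G1 by simp
  have F'G: "integrable lebesgue (\<lambda>\<xi>. fourier_integral v \<xi> * cnj (G \<xi>))"
    by (rule integrable_bounded_mult[OF Gc fourier_integral_measurable[OF v] fourier_integral_bounded[OF v]])
  have norm_G: "(LINT \<xi>|lebesgue. (cmod (G \<xi>))\<^sup>2) = 2 * pi * (LINT x|lebesgue. (cmod (\<phi> x))\<^sup>2)"
  proof -
    have "(LINT \<xi>|lebesgue. (cmod (G \<xi>))\<^sup>2) = (LINT \<xi>|lebesgue. (cmod (g \<xi>))\<^sup>2)"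
      by (rule integral_cong_AE) (use gG2 in auto)
    then show ?thesis using fourier_plancherel[OF FT\<phi> g1] by simp
  qed
  \<comment> \<open>By the multiplication formula and inversion the integral is \<open>- 2 pi i\<close> times that of \<open>x u \<bar>\<phi>\<bar>\<^sup>2\<close>, which is real because \<open>u\<close> is.\<close>
  have cross: "Re (LINT \<xi>|lebesgue. fourier_integral v \<xi> * cnj (G \<xi>)) = 0"
  proof -
    have gc: "integrable lebesgue (\<lambda>\<xi>. cnj (g \<xi>))" using g1 by simp
    have [measurable]: "fourier_integral v \<in> borel_measurable lebesgue" "fourier_integral (\<lambda>\<xi>. cnj (g \<xi>)) \<in> borel_measurable lebesgue"
      "v \<in> borel_measurable lebesgue" "(\<lambda>x::real. x) \<in> borel_measurable lebesgue" "u \<in> borel_measurable lebesgue"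
      using v assms(1) by (auto intro: borel_imp_lebesgue_measurable fourier_integral_measurable[OF v] fourier_integral_measurable[OF gc] L2_measurable)
    have "(LINT \<xi>|lebesgue. fourier_integral v \<xi> * cnj (G \<xi>)) = (LINT \<xi>|lebesgue. fourier_integral v \<xi> * cnj (g \<xi>))"
    proof (rule integral_cong_AE)
      show "AE \<xi> in lebesgue. fourier_integral v \<xi> * cnj (G \<xi>) = fourier_integral v \<xi> * cnj (g \<xi>)"
        using gG by eventually_elim simp
      show "(\<lambda>\<xi>. fourier_integral v \<xi> * cnj (g \<xi>)) \<in> borel_measurable lebesgue"
        using borel_measurable_integrable[OF gc] by measurable
    qed (use F'G in auto)
    also have "\<dots> = (LINT x|lebesgue. v x * fourier_integral (\<lambda>\<xi>. cnj (g \<xi>)) x)"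
      by (rule fourier_integral_multiplication[OF v gc, symmetric])
    also have "\<dots> = (LINT x|lebesgue. - \<i> * of_real (2 * pi * (x * u x * (cmod (\<phi> x))\<^sup>2)))"
    proof (rule integral_cong_AE)
      show "AE x in lebesgue. v x * fourier_integral (\<lambda>\<xi>. cnj (g \<xi>)) x = - \<i> * of_real (2 * pi * (x * u x * (cmod (\<phi> x))\<^sup>2))"
        using fourier_inversion[OF FT\<phi> g1] p_eq
      proof eventually_elim
        case (elim x)
        have "v x * fourier_integral (\<lambda>\<xi>. cnj (g \<xi>)) x = - \<i> * of_real (2 * pi * (x * u x)) * (\<phi> x * cnj (\<phi> x))"
          unfolding fourier_integral_cnj elim(1) v_def w_def elim(2) by simp
        then show ?case
          by (simp only: complex_norm_square[symmetric] mult.assoc of_real_mult)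
      qed
    qed measurable
    also have "\<dots> = - \<i> * of_real (LINT x|lebesgue. 2 * pi * (x * u x * (cmod (\<phi> x))\<^sup>2))"
      by (simp only: integral_mult_right_zero integral_complex_of_real)
    finally show ?thesis by simp
  qed
  have "(cmod (F 0))\<^sup>2 / \<bar>l\<bar> = 2 * pi * (LINT x|lebesgue. (cmod (\<phi> x))\<^sup>2)"
    using half_line_boundary_identity[OF l dF fourier_integral_isCont[OF v] _ G_def G2 F'G, of "LINT x|lebesgue. cmod (w x)"]
      fourier_integral_bounded[OF w]
    by (simp add: F_def norm_G cross)
  moreover have "F 0 = (LINT x|lebesgue. of_real (u x) * \<phi> x)"
  proof -
    have "F 0 = (LINT x|lebesgue. w x)" by (simp add: F_def fourier_integral_def)
    also have "\<dots> = (LINT x|lebesgue. of_real (u x) * \<phi> x)"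
    proof (rule integral_cong_AE)
      show "AE x in lebesgue. w x = of_real (u x) * \<phi> x"
        using p_eq by eventually_elim (simp add: w_def)
    qed (use w in auto)
    finally show ?thesis .
  qed
  ultimately show ?thesis
    using l by (simp add: field_simps)
qed

end
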